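(* Let $d\ge1$ and let $i,j\ge0$ with $i+j=k$. The number of noncrossing partitions $\pi\in\mathrm{NC}^d_{dk+1}$ of rank $j$ (i.e. with $(dk+1-|\pi|)/d=j$) such that every block of $\pi$ has size $1$ or $d+1$ and every block of the dual partition $\pi'$ has size $1$ or $d+1$ is $$\frac{dk+1}{(dj+1)(di+1)}\binom{dj+1}{i}\binom{di+1}{j}.$$
   Context: A partition of $[n]$ is noncrossing if there are no $i<j<k<\ell$ with $i,k$ in one block and $j,\ell$ in a different block. The Kreweras dual $\pi'$ of a noncrossing partition $\pi$ of $[n]$: place $1,1',2,2',\dots,n,n'$ on a circle in this cyclic order; $\pi'$ is the coarsest partition of $\{1',\dots,n'\}$ such that the blocks of $\pi$ and of $\pi'$ together form a noncrossing partition of these $2n$ points. $\mathrm{NC}^d_n$ is the poset, ordered by refinement, of noncrossing partitions $\pi$ of $[n]$ such that every block of $\pi$ and of $\pi'$ has cardinality congruent to $1$ modulo $d$. $|\pi|$ is the number of blocks of $\pi$. *)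

theory Defs
  imports Complex_Main "HOL-Library.Disjoint_Sets" "HOL-Number_Theory.Cong"
begin

definition noncrossing :: "nat set set \<Rightarrow> bool" where
  "noncrossing P \<longleftrightarrow>
     \<not> (\<exists>B\<in>P. \<exists>C\<in>P. B \<noteq> C \<and>
          (\<exists>i\<in>B. \<exists>j\<in>C. \<exists>k\<in>B. \<exists>l\<in>C. i < j \<and> j < k \<and> k < l))"

definition NC :: "nat \<Rightarrow> nat set set set" where
  "NC n = {P. partition_on {1..n} P \<and> noncrossing P}"

text \<open>
  The points 1, 1', 2, 2', ..., n, n' on the circle are encoded as the numbers
  2, 3, 4, 5, ..., 2n, 2n+1: the point i becomes 2i and the point i' becomes 2i+1.
  A partition \<open>Q\<close> of the primed points is represented by the corresponding partition
  of \<open>{1..n}\<close>.  Being noncrossing does not depend on where the cyclic order is cut open.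
\<close>

definition interleave :: "nat set set \<Rightarrow> nat set set \<Rightarrow> nat set set" where
  "interleave P Q = (\<lambda>B. (\<lambda>i. 2 * i) ` B) ` P \<union> (\<lambda>B. (\<lambda>i. 2 * i + 1) ` B) ` Q"

definition kreweras_compatible :: "nat \<Rightarrow> nat set set \<Rightarrow> nat set set \<Rightarrow> bool" where
  "kreweras_compatible n P Q \<longleftrightarrow> partition_on {1..n} Q \<and> noncrossing (interleave P Q)"

text \<open>
  Coarsest means greatest in the refinement order.  This description determines the
  dual uniquely for \<open>P \<in> NC n\<close>; for other \<open>P\<close> the value is irrelevant.
\<close>

definition kreweras :: "nat \<Rightarrow> nat set set \<Rightarrow> nat set set" where
  "kreweras n P = (THE Q. kreweras_compatible n P Q \<and>
     (\<forall>R. kreweras_compatible n P R \<longrightarrow> refines {1..n} R Q))"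

definition NC_mod :: "nat \<Rightarrow> nat \<Rightarrow> nat set set set" where
  "NC_mod d n = {P \<in> NC n. (\<forall>B\<in>P. [card B = 1] (mod d)) \<and>
                           (\<forall>B\<in>kreweras n P. [card B = 1] (mod d))}"

definition NC_rank :: "nat \<Rightarrow> nat \<Rightarrow> nat set set \<Rightarrow> real" where
  "NC_rank d n P = (real n - real (card P)) / real d"

end

theory Submission
  imports Defs "HOL-Computational_Algebra.Polynomial"
begin

text \<open>
  In \<open>\<pi>'\<close> the points \<open>x'\<close> and \<open>y'\<close> share a block iff the cuts of \<open>[n]\<close> just after \<open>x\<close> and just
  after \<open>y\<close> separate the same pairs of \<open>\<pi>\<close>-equivalent points. Root a noncrossing partition of an
  interval \<open>[a, b]\<close> at the block of \<open>b\<close>, of size \<open>q + 1\<close>, and the dual block of \<open>b'\<close>, of size \<open>p + 1\<close>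
  (blocks and dual blocks are the two colour classes of a plane tree with edge set \<open>[a, b]\<close>).
  If \<open>a\<close> and \<open>b\<close> are in the same block, then \<open>p = 0\<close>, and deleting \<open>a\<close> loses no information. Otherwise
  the partition splits after the last element of the block of \<open>a\<close>. Hence the partitions with all
  unrooted blocks and dual blocks of size \<open>1\<close> or \<open>d + 1\<close> are counted by \<open>\<beta>\<^sup>p \<omega>\<^sup>q\<close>, where
  \<open>\<beta> = 1 + u \<omega>\<^sup>d\<close> and \<open>\<omega> = 1 + v \<beta>\<^sup>d\<close>, and the required number is the coefficient of \<open>u\<^sup>j v\<^sup>i\<close> in \<open>\<beta> \<omega>\<close>.
  The closed form of the coefficients of \<open>\<beta>\<^sup>p \<omega>\<^sup>q\<close> satisfies the recursions
  \<open>\<beta>\<^sup>p\<^sup>+\<^sup>1 \<omega>\<^sup>q = \<beta>\<^sup>p \<omega>\<^sup>q + u \<beta>\<^sup>p \<omega>\<^sup>q\<^sup>+\<^sup>d\<close> and \<open>\<beta>\<^sup>p \<omega>\<^sup>q\<^sup>+\<^sup>1 = \<beta>\<^sup>p \<omega>\<^sup>q + v \<beta>\<^sup>p\<^sup>+\<^sup>d \<omega>\<^sup>q\<close>.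
\<close>

section \<open>Powers of the tree series\<close>

text \<open>
  The coefficient of \<open>t\<^sup>m\<close> in \<open>\<beta>\<^sup>p \<omega>\<^sup>q\<close> when every vertex carries a factor \<open>t\<close>, that is
  \<open>\<beta> = t (1 + x \<omega>\<^sup>d)\<close> and \<open>\<omega> = t (1 + \<beta>\<^sup>d)\<close>.
\<close>

fun forest_gf :: "'a::comm_semiring_1 \<Rightarrow> nat \<Rightarrow> nat \<Rightarrow> nat \<Rightarrow> nat \<Rightarrow> 'a" where
  "forest_gf x d p q 0 = (if p = 0 \<and> q = 0 then 1 else 0)"
| "forest_gf x d (Suc p) q (Suc m) = forest_gf x d p q m + x * forest_gf x d p (q + d) m"
| "forest_gf x d 0 (Suc q) (Suc m) = forest_gf x d 0 q m + forest_gf x d d q m"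
| "forest_gf x d 0 0 (Suc m) = 0"

text \<open>The definition peels off a factor \<omega> only when p = 0. For p > 0, expand one
  \<beta> on both sides: expanding a \<beta> and expanding an \<omega> commute.\<close>

lemma forest_gf_Suc_right:
  "forest_gf x d p (Suc q) (Suc m) = forest_gf x d p q m + forest_gf x d (p + d) q m"
proof (induction p arbitrary: q m)
  case (Suc p)
  show ?case
  proof (cases m)
    case (Suc m')
    have *: "Suc q + d = Suc (q + d)" by simp
    show ?thesis
      unfolding Suc forest_gf.simps * Suc.IH add_Suc by (simp add: algebra_simps)
  qed simp
qed simp

text \<open>Cauchy product of \<beta>^p \<omega>^q with a second such power. Expanding one factor of
  the first power lowers \<open>m\<close> by one, and the empty power contributes only at l =
  0.\<close>

lemma forest_gf_convolution:
  "(\<Sum>l\<le>m. forest_gf x d p q l * forest_gf x d p' q' (m - l)) = forest_gf x d (p + p') (q + q') m"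
proof (induction m arbitrary: p q p' q')
  case (Suc m)
  show ?case
  proof (cases p)
    case (Suc r)
    have "(\<Sum>l\<le>Suc m. forest_gf x d p q l * forest_gf x d p' q' (Suc m - l))
        = (\<Sum>l\<le>m. forest_gf x d p q (Suc l) * forest_gf x d p' q' (m - l))"
      by (subst sum.atMost_Suc_shift) (simp add: Suc)
    also have "\<dots> = (\<Sum>l\<le>m. forest_gf x d r q l * forest_gf x d p' q' (m - l))
        + x * (\<Sum>l\<le>m. forest_gf x d r (q + d) l * forest_gf x d p' q' (m - l))"
      by (simp add: Suc algebra_simps sum.distrib sum_distrib_left)
    finally show ?thesis unfolding Suc.IH by (simp add: Suc add_ac)
  next
    case p0: 0
    show ?thesis
    proof (cases q)
      case (Suc r)
      have "(\<Sum>l\<le>Suc m. forest_gf x d p q l * forest_gf x d p' q' (Suc m - l))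
          = (\<Sum>l\<le>m. forest_gf x d p q (Suc l) * forest_gf x d p' q' (m - l))"
        by (subst sum.atMost_Suc_shift) (simp add: Suc)
      also have "\<dots> = (\<Sum>l\<le>m. forest_gf x d 0 r l * forest_gf x d p' q' (m - l))
          + (\<Sum>l\<le>m. forest_gf x d d r l * forest_gf x d p' q' (m - l))"
        by (simp add: Suc p0 algebra_simps sum.distrib)
      finally show ?thesis
        unfolding Suc.IH by (simp add: Suc p0 forest_gf_Suc_right add_ac)
    next
      case 0
      then show ?thesis by (subst sum.atMost_Suc_shift) (simp add: p0)
    qed
  qed
qed auto

text \<open>Each factor x of \<beta> = t (1 + x \<omega>^d) brings at least d further factors t, so
  t^m x^j can occur in \<beta>^p \<omega>^q only from m = p + q + d j on.\<close>

lemma coeff_forest_gf_eq_0: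
  "m < p + q + d * j \<Longrightarrow> coeff (forest_gf [:0, 1:] d p q m) j = 0"
proof (induction m arbitrary: p q j)
  case 0
  then show ?case by (cases j) (auto simp: coeff_pCons one_pCons)
next
  case (Suc m)
  show ?case
  proof (cases p)
    case (Suc r)
    with Suc.prems Suc.IH show ?thesis by (cases j) auto
  next
    case p0: 0
    show ?thesis 
    proof (cases q)
      case (Suc r)
      with p0 Suc.prems Suc.IH show ?thesis by auto
    qed (simp add: p0)
  qed
qed

text \<open>At the least possible exponent of t, \<omega> contributes only its leading term t, so
  \<beta> acts as t (1 + x t^d).\<close>

lemma coeff_forest_gf_i_0:
  assumes "d \<ge> 1"
  shows "m = p + q + d * j \<Longrightarrow> coeff (forest_gf [:0, 1:] d p q m) j = real (p choose j)"
proof (induction m arbitrary: p q j)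
  case 0
  then show ?case using assms by (auto simp: one_pCons)
next
  case (Suc m)
  show ?case
  proof (cases p)
    case p: (Suc r)
    show ?thesis
    proof (cases j)
      case 0
      then show ?thesis using Suc.IH[of r q 0] Suc.prems p by simp
    next
      case j: (Suc j')
      have "coeff (forest_gf [:0, 1:] d r q m) j = real (r choose j)"
        "coeff (forest_gf [:0, 1:] d r (q + d) m) j' = real (r choose j')"
        using Suc.IH[of r q j] Suc.IH[of r "q + d" j'] Suc.prems p j by (simp_all add: add_ac)
      then show ?thesis using p j by (simp add: add_ac)
    qed
  next
    case p0: 0
    show ?thesis
    proof (cases q)
      case (Suc r)
      have "coeff (forest_gf [:0, 1:] d 0 r m) j = real (0 choose j)"
        using Suc.prems p0 Suc by (intro Suc.IH) auto
      \<comment> \<open>Expanding \<omega> through \<beta>^d would exceed the least possible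
        exponent of t.\<close>
      moreover have "coeff (forest_gf [:0, 1:] d d r m) j = 0"
        using Suc.prems p0 Suc assms by (intro coeff_forest_gf_eq_0) auto
      ultimately show ?thesis using p0 Suc by simp
    next
      case 0
      then have "j > 0" using Suc.prems p0 by (cases j) auto
      then show ?thesis using p0 0 by simp
    qed
  qed
qed

text \<open>The difference is taken in the reals, so the identity also covers k > n, where both
  binomials vanish.\<close>

lemma Suc_times_choose_Suc: "real (Suc k) * real (n choose Suc k) = (real n - real k) * real (n choose k)"
proof (cases "k \<le> n")
  case True
  have "Suc k * (n choose Suc k) = (n - k) * (n choose k)"
    by (metis binomial_absorb_comp binomial_absorption)
  then have "real (Suc k * (n choose Suc k)) = real ((n - k) * (n choose k))" by simp
  then show ?thesis using True by (simp only: of_nat_mult of_nat_diff)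
qed (simp add: binomial_eq_0)

text \<open>Bivariate Lagrange inversion: the left-hand side is \<open>i + 1\<close> times the coefficient of
  \<open>u\<^sup>j v\<^sup>i\<^sup>+\<^sup>1\<close> in \<open>\<beta>\<^sup>p \<omega>\<^sup>q\<close>.\<close>
lemma coeff_forest_gf_i_Suc:
  fixes d i :: nat
  assumes d: "d \<ge> 1"
  shows "m = p + q + d * (Suc i + j) \<Longrightarrow>
    real (Suc i) * coeff (forest_gf [:0, 1:] d p q m) j =
    real ((d * j + q - 1) choose i) * (real q * real ((p + d * Suc i) choose j)
      + (if j = 0 then 0 else real (p * d) * real ((p + d * Suc i - 1) choose (j - 1))))"
proof (induction m arbitrary: p q i j)
  case 0
  then show ?case using d by auto
next
  case (Suc m)
  show ?case
  proof (cases p)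
    case p: (Suc r)
    \<comment> \<open>\<open>N\<close> stands for p + d (i + 1) - 2; naming it keeps truncated
      subtraction out of Pascal's rule.\<close>
    obtain N where N: "r + d * Suc i = Suc N"
      using d by (cases "r + d * Suc i") auto
    have N': "p + d * Suc i = Suc (Suc N)" using N p by simp
    have 1: "real (Suc i) * coeff (forest_gf [:0, 1:] d r q m) j =
      real ((d * j + q - 1) choose i) * (real q * real (Suc N choose j)
      + (if j = 0 then 0 else real (r * d) * real (N choose (j - 1))))"
      using Suc.IH[of r q i j] Suc.prems p unfolding N by (simp add: add_ac)
    show ?thesis
    proof (cases j)
      case 0
      then show ?thesis using 1 unfolding N' by (simp add: p)
    next
      case j: (Suc j')
      have 2: "real (Suc i) * coeff (forest_gf [:0, 1:] d r (q + d) m) j' =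
        real ((d * j' + (q + d) - 1) choose i) * (real (q + d) * real (Suc N choose j')
        + (if j' = 0 then 0 else real (r * d) * real (N choose (j' - 1))))"
        using Suc.IH[of r "q + d" i j'] Suc.prems p j unfolding N by (simp add: algebra_simps)
      \<comment> \<open>The extra \<omega>^d makes up for the lost x, so both terms share this
        binomial and Pascal's rule for the other one finishes the case.\<close>
      have 3: "d * j' + (q + d) - 1 = d * j + q - 1" using j by simp
      have "real (Suc i) * coeff (forest_gf [:0, 1:] d p q (Suc m)) j =
        real (Suc i) * coeff (forest_gf [:0, 1:] d r q m) j +
        real (Suc i) * coeff (forest_gf [:0, 1:] d r (q + d) m) j'"
        using p j by (simp add: algebra_simps)
      also have "\<dots> = real ((d * j + q - 1) choose i) *
         (real q * real (Suc N choose j) + real (r * d) * real (N choose j')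
          + real (q + d) * real (Suc N choose j')
          + (if j' = 0 then 0 else real (r * d) * real (N choose (j' - 1))))"
        unfolding 1 2 3 using j by (simp add: algebra_simps)
      also have "\<dots> = real ((d * j + q - 1) choose i) * (real q * real (Suc (Suc N) choose j)
           + real (p * d) * real (Suc N choose j'))"
        using j p by (cases j') (simp_all add: algebra_simps)
      finally show ?thesis using j unfolding N' by simp
    qed
  next
    case p0: 0
    show ?thesis
    proof (cases q)
      case q: (Suc r)
      have 1: "real (Suc i) * coeff (forest_gf [:0, 1:] d 0 r m) j =
        real ((d * j + r - 1) choose i) * (real r * real ((d * Suc i) choose j))"
        using Suc.IH[of 0 r i j] Suc.prems p0 q by simp
      have goal: "real (Suc i) * (coeff (forest_gf [:0, 1:] d 0 r m) j + coeff (forest_gf [:0, 1:] d d r m) j)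
          = real ((d * j + r) choose i) * (real (Suc r) * real ((d * Suc i) choose j))"
      proof (cases i)
        case 0
        \<comment> \<open>For i = 0 the term \<beta>^d \<omega>^r is already at the least exponent
          of t.\<close>
        have "coeff (forest_gf [:0, 1:] d d r m) j = real (d choose j)"
          using Suc.prems p0 q 0 d by (intro coeff_forest_gf_i_0) (auto simp: algebra_simps)
        then show ?thesis using 1 0 by (simp add: algebra_simps)
      next
        case i: (Suc i')
        let ?c1 = "coeff (forest_gf [:0, 1:] d 0 r m) j :: real"
        let ?c2 = "coeff (forest_gf [:0, 1:] d d r m) j :: real"
        define M where "M = d * Suc i"
        have M: "d + d * Suc i' = M" using i M_def by simp
        \<comment> \<open>Absorption with M = d (i + 1) turns the bracket of the induction
          hypothesis into a multiple of \<open>M choose j\<close>.\<close>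
        have "real (Suc i) * real d * real (M - 1 choose (j - 1)) = real j * real (M choose j)" if "j \<noteq> 0"
          using that times_binomial_minus1_eq[of j M] M_def
          by (metis mult.commute of_nat_mult bot_nat_0.not_eq_extremum)
        then have absorb: "real (Suc i) * real (d * d) * real (M - 1 choose (j - 1)) = real d * real j * real (M choose j)" if "j \<noteq> 0"
          using that by (metis (no_types, opaque_lifting) mult.assoc mult.left_commute of_nat_mult)
        have "real (Suc i') * ?c2 = real ((d * j + r - 1) choose i') * (real r * real (M choose j)
          + (if j = 0 then 0 else real (d * d) * real ((M - 1) choose (j - 1))))"
          using Suc.IH[of d r i' j] Suc.prems p0 q i unfolding M by (simp add: algebra_simps)
        then have "real (Suc i) * (real (Suc i') * ?c2) = real (Suc i) * (real ((d * j + r - 1) choose i') * (real r * real (M choose j)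
          + (if j = 0 then 0 else real (d * d) * real ((M - 1) choose (j - 1)))))" by simp
        also have "\<dots> = real ((d * j + r - 1) choose i') * (real (Suc i) * real r * real (M choose j)
          + (if j = 0 then 0 else real (Suc i) * real (d * d) * real ((M - 1) choose (j - 1))))"
          by (simp add: algebra_simps)
        also have "\<dots> = real ((d * j + r - 1) choose i') * (real (Suc i) * real r + real d * real j) * real (M choose j)"
          using absorb by (simp add: algebra_simps)
        finally have 2: "real (Suc i) * (real (Suc i') * ?c2) =
          real ((d * j + r - 1) choose i') * (real (Suc i) * real r + real d * real j) * real (M choose j)" .
        \<comment> \<open>The formulas for the two terms have denominators i + 1 and i' + 1; both
          are cleared at once.\<close>
        have "real (Suc i') * (real (Suc i) * (?c1 + ?c2)) =
          real (Suc i') * (real (Suc i) * ?c1) + real (Suc i) * (real (Suc i') * ?c2)"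
          by (simp add: algebra_simps)
        also have "\<dots> = (real r * (real (Suc i') * real ((d * j + r - 1) choose Suc i')) +
            real ((d * j + r - 1) choose i') * (real (Suc i) * real r + real d * real j)) * real (M choose j)"
          unfolding 1 2 M_def[symmetric] unfolding i by (simp add: algebra_simps)
        also have "\<dots> = real (Suc i') * (real ((d * j + r) choose i) * (real (Suc r) * real (M choose j)))"
        \<comment> \<open>The difference d j + r - 1 is truncated only if r = 0 and d j = 0, and
          then both sides vanish.\<close>
        proof (cases "d * j + r")
          case 0
          then show ?thesis using i d by simp
        next
          case (Suc N)
          then have Nr: "real d * real j + real r = real N + 1"
            by (metis of_nat_Suc of_nat_add of_nat_mult add.commute)
          have dj: "real d * real j = real N + 1 - real r" using Nr by simp
          have "real (Suc i') * (real (Suc N choose Suc i') * real (Suc r)) =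
            real (Suc r) * (real (Suc i') * real (N choose Suc i') + real (Suc i') * real (N choose i'))"
            by (simp add: algebra_simps)
          also have "\<dots> = real r * (real (Suc i') * real (N choose Suc i')) +
            real (N choose i') * (real (Suc i) * real r + real d * real j)"
            unfolding Suc_times_choose_Suc dj using i by (simp add: algebra_simps)
          finally show ?thesis using i unfolding Suc by simp
        qed
        finally have "real (Suc i') * (real (Suc i) * (?c1 + ?c2)) =
          real (Suc i') * (real ((d * j + r) choose i) * (real (Suc r) * real (M choose j)))" .
        then show ?thesis unfolding M_def by simp
      qed
      then show ?thesis using p0 q by simp
    next
      case 0
      then show ?thesis using p0 by simp
    qed
  qed
qed

section \<open>The Kreweras dual\<close>

text \<open>The union makes the notion total; for a partition it is the unique block through
  \<open>x\<close>.\<close>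

definition block_of :: "'a set set \<Rightarrow> 'a \<Rightarrow> 'a set" where
  "block_of P x = \<Union>{B \<in> P. x \<in> B}"

definition same_cut :: "nat set set \<Rightarrow> nat \<Rightarrow> nat \<Rightarrow> bool" where
  "same_cut P x y \<longleftrightarrow> (\<forall>B\<in>P. \<forall>u\<in>B. \<forall>v\<in>B. (u \<le> x \<and> x < v) \<longleftrightarrow> (u \<le> y \<and> y < v))"

definition dual_class :: "nat set \<Rightarrow> nat set set \<Rightarrow> nat \<Rightarrow> nat set" where
  "dual_class A P x = {y \<in> A. same_cut P x y}"

definition dual :: "nat set \<Rightarrow> nat set set \<Rightarrow> nat set set" where
  "dual A P = dual_class A P ` A"

text \<open>Ground sets other than [n] occur because the recursion passes to subintervals.\<close>

definition ncp :: "nat set \<Rightarrow> nat set set set" where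
  "ncp A = {P. partition_on A P \<and> noncrossing P}"

lemma noncrossingD:
  "noncrossing P \<Longrightarrow> B \<in> P \<Longrightarrow> C \<in> P \<Longrightarrow> i \<in> B \<Longrightarrow> j \<in> C \<Longrightarrow> k \<in> B \<Longrightarrow> l \<in> C
    \<Longrightarrow> i < j \<Longrightarrow> j < k \<Longrightarrow> k < l \<Longrightarrow> B = C"
  unfolding noncrossing_def by metis

lemma noncrossingI:
  assumes "\<And>B C i j k l. B \<in> P \<Longrightarrow> C \<in> P \<Longrightarrow> i \<in> B \<Longrightarrow> j \<in> C \<Longrightarrow> k \<in> B \<Longrightarrow> l \<in> C
    \<Longrightarrow> i < j \<Longrightarrow> j < k \<Longrightarrow> k < l \<Longrightarrow> B = C"
  shows "noncrossing P"
  unfolding noncrossing_def using assms by metis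

lemma same_cutD:
  "same_cut P x y \<Longrightarrow> B \<in> P \<Longrightarrow> u \<in> B \<Longrightarrow> v \<in> B \<Longrightarrow> (u \<le> x \<and> x < v) \<longleftrightarrow> (u \<le> y \<and> y < v)"
  unfolding same_cut_def by (drule (1) bspec)+

lemma same_cutI:
  assumes "\<And>B u v. B \<in> P \<Longrightarrow> u \<in> B \<Longrightarrow> v \<in> B \<Longrightarrow> (u \<le> x \<and> x < v) \<longleftrightarrow> (u \<le> y \<and> y < v)"
  shows "same_cut P x y"
  unfolding same_cut_def by (intro ballI assms)

lemma same_cut_refl [simp]: "same_cut P x x"
  by (simp add: same_cut_def)

lemma same_cut_sym: "same_cut P x y \<Longrightarrow> same_cut P y x"
  by (rule same_cutI, rule same_cutD[symmetric])

lemma same_cut_trans: "same_cut P x y \<Longrightarrow> same_cut P y z \<Longrightarrow> same_cut P x z"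
  by (rule same_cutI, rule trans[OF same_cutD same_cutD])

lemma dual_class_eq: "same_cut P x y \<Longrightarrow> dual_class A P x = dual_class A P y"
  unfolding dual_class_def by (metis same_cut_sym same_cut_trans)

lemma partition_on_dual: "partition_on A (dual A P)"
proof (rule partition_onI)
  fix p q assume "p \<in> dual A P" "q \<in> dual A P" "p \<noteq> q"
  then obtain x y where xy: "p = dual_class A P x" "q = dual_class A P y" "\<not> same_cut P x y"
    unfolding dual_def using dual_class_eq by blast
  show "disjnt p q"
    unfolding xy disjnt_iff dual_class_def mem_Collect_eq using xy(3) by (metis same_cut_sym same_cut_trans)
qed (auto simp: dual_def dual_class_def)

lemma partition_on_unique: "partition_on A P \<Longrightarrow> B \<in> P \<Longrightarrow> C \<in> P \<Longrightarrow> x \<in> B \<Longrightarrow> x \<in> C \<Longrightarrow> B = C"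
  unfolding partition_on_def disjoint_def by blast

text \<open>A pair u, v separated by the cut after x but not by the one after y would alternate on
  the circle with x' and y', forcing a set of even numbers to equal a set of odd numbers.\<close>

lemma same_cut_if_noncrossing_interleave:
  assumes nc: "noncrossing (interleave P Q)" and V: "V \<in> Q" "x \<in> V" "y \<in> V"
  shows "same_cut P x y"
proof (rule same_cutI)
  have *: "u \<le> y \<and> y < v" if B: "B \<in> P" "u \<in> B" "v \<in> B" and xy: "x \<in> V" "y \<in> V" "u \<le> x" "x < v"
    for B u v x y
  proof (rule ccontr)
    assume not: "\<not> (u \<le> y \<and> y < v)"
    have mem: "(\<lambda>i. 2 * i) ` B \<in> interleave P Q" "(\<lambda>i. 2 * i + 1) ` V \<in> interleave P Q"
      using B V by (auto simp: interleave_def)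
    have pts: "2 * u \<in> (\<lambda>i. 2 * i) ` B" "2 * v \<in> (\<lambda>i. 2 * i) ` B"
      "2 * x + 1 \<in> (\<lambda>i. 2 * i + 1) ` V" "2 * y + 1 \<in> (\<lambda>i. 2 * i + 1) ` V"
      using B xy by auto
    have "(\<lambda>i. 2 * i) ` B = (\<lambda>i. 2 * i + 1) ` V"
    \<comment> \<open>The alternating order is y', u, x', v if y < u, and u, x', v, y'
      otherwise.\<close>
    proof (cases "y < u")
      case True
      then show ?thesis
        using noncrossingD[OF nc mem(2,1) pts(4,1,3,2)] xy by simp
    next
      case False
      then show ?thesis
        using noncrossingD[OF nc mem(1,2) pts(1,3,2,4)] xy not by simp
    qed
    then have "2 * u \<in> (\<lambda>i. 2 * i + 1) ` V" using pts(1) by simp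
    then obtain w where "2 * u = 2 * w + 1" by auto
    then show False by presburger
  qed
  fix B u v assume "B \<in> P" "u \<in> B" "v \<in> B"
  then show "(u \<le> x \<and> x < v) \<longleftrightarrow> (u \<le> y \<and> y < v)"
    using *[of B u v x y] *[of B u v y x] V by blast
qed

text \<open>A crossing of a block with a dual class exhibits a pair that only one of two equivalent
  cuts separates; two crossing dual classes turn out to coincide.\<close>

lemma noncrossing_interleave_dual:
  assumes "noncrossing P"
  shows "noncrossing (interleave P (dual A P))"
proof (rule noncrossingI)
  fix X Y i j k l
  assume XY: "X \<in> interleave P (dual A P)" "Y \<in> interleave P (dual A P)"
    and mem: "i \<in> X" "j \<in> Y" "k \<in> X" "l \<in> Y" and less: "i < j" "j < k" "k < l"
  have cross: False if "B \<in> P" "u \<in> B" "v \<in> B" "same_cut P x y" "u \<le> x \<and> x < v" "\<not> (u \<le> y \<and> y < v)" for B u v x y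
    using that same_cutD by blast
  have dualD: "same_cut P x y" if "x \<in> V" "y \<in> V" "V \<in> dual A P" for x y V
  proof -
    obtain z where "V = dual_class A P z" using \<open>V \<in> dual A P\<close> by (auto simp: dual_def)
    then have "same_cut P z x" "same_cut P z y" using that by (auto simp: dual_class_def)
    then show ?thesis using same_cut_sym same_cut_trans by metis
  qed
  consider (PP) B C where "B \<in> P" "C \<in> P" "X = (\<lambda>i. 2 * i) ` B" "Y = (\<lambda>i. 2 * i) ` C"
    | (PQ) B V where "B \<in> P" "V \<in> dual A P" "X = (\<lambda>i. 2 * i) ` B" "Y = (\<lambda>i. 2 * i + 1) ` V"
    | (QP) V B where "V \<in> dual A P" "B \<in> P" "X = (\<lambda>i. 2 * i + 1) ` V" "Y = (\<lambda>i. 2 * i) ` B"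
    | (QQ) V W where "V \<in> dual A P" "W \<in> dual A P" "X = (\<lambda>i. 2 * i + 1) ` V" "Y = (\<lambda>i. 2 * i + 1) ` W"
    using XY unfolding interleave_def by blast
  then show "X = Y"
  proof cases
    case PP
    then obtain i' j' k' l' where "i = 2 * i'" "j = 2 * j'" "k = 2 * k'" "l = 2 * l'"
       "i' \<in> B" "j' \<in> C" "k' \<in> B" "l' \<in> C" using mem by blast
    then have "B = C"
      using less by (intro noncrossingD[OF assms PP(1,2), of i' j' k' l']) auto
    then show ?thesis using PP by simp
  next
    case PQ
    then obtain i' j' k' l' where eq: "i = 2 * i'" "j = 2 * j' + 1" "k = 2 * k'" "l = 2 * l' + 1"
       and "i' \<in> B" "j' \<in> V" "k' \<in> B" "l' \<in> V" using mem by blast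
    then have False
      using less cross[OF PQ(1), of i' k' j' l'] dualD PQ(2) by simp
    then show ?thesis ..
  next
    case QP
    then obtain i' j' k' l' where eq: "i = 2 * i' + 1" "j = 2 * j'" "k = 2 * k' + 1" "l = 2 * l'"
       and "i' \<in> V" "j' \<in> B" "k' \<in> V" "l' \<in> B" using mem by blast
    then have False
      using less cross[OF QP(2), of j' l' k' i'] dualD QP(1) by simp
    then show ?thesis ..
  next
    case QQ
    then obtain i' j' k' l' where eq: "i = 2 * i' + 1" "j = 2 * j' + 1" "k = 2 * k' + 1" "l = 2 * l' + 1"
       and m: "i' \<in> V" "j' \<in> W" "k' \<in> V" "l' \<in> W" using mem by blast
    have 1: "same_cut P i' k'" "same_cut P j' l'" using m dualD QQ(1,2) by blast+
    have lt: "i' < j'" "j' < k'" "k' < l'" using less eq by auto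
    \<comment> \<open>A pair separated by only one of the cuts j' and k' has an end between them.
      Then i' and k', or j' and l', would differ on this pair.\<close>
    have "same_cut P j' k'"
    proof (rule same_cutI)
      fix B u v assume B: "B \<in> P" "u \<in> B" "v \<in> B"
      show "(u \<le> j' \<and> j' < v) \<longleftrightarrow> (u \<le> k' \<and> k' < v)"
        using same_cutD[OF 1(1) B] same_cutD[OF 1(2) B] lt by auto
    qed
    moreover have "k' \<in> A" using m(3) QQ(1) by (auto simp: dual_def dual_class_def)
    moreover obtain z where z: "W = dual_class A P z" using QQ(2) by (auto simp: dual_def)
    moreover have "same_cut P z j'" using m(2) z by (simp add: dual_class_def)
    ultimately have "k' \<in> W" using same_cut_trans[of P z j' k'] by (simp add: dual_class_def)
    then have "V = W" using partition_on_unique[OF partition_on_dual QQ(1,2)] m by blast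
    then show ?thesis using QQ by simp
  qed
qed

text \<open>A compatible partition joins only points with equivalent cuts, hence refines
  \<open>dual\<close>, which is itself compatible. Antisymmetry of refinement gives
  uniqueness.\<close>

lemma kreweras_eq_dual:
  assumes "P \<in> NC n"
  shows "kreweras n P = dual {1..n} P"
  unfolding kreweras_def
proof (rule the_equality)
  have P: "noncrossing P" using assms by (simp add: NC_def)
  have "refines {1..n} R (dual {1..n} P)" if R: "kreweras_compatible n P R" for R
    unfolding refines_def
  proof (intro conjI ballI partition_on_dual)
    show part: "partition_on {1..n} R" using R by (simp add: kreweras_compatible_def)
    fix V assume V: "V \<in> R"
    then obtain x where x: "x \<in> V" using partition_onD3[OF part] by (metis ex_in_conv)
    have "V \<subseteq> {1..n}" using V partition_onD1[OF part] by blast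
    moreover have "same_cut P x y" if "y \<in> V" for y
      using same_cut_if_noncrossing_interleave V x that R unfolding kreweras_compatible_def by blast
    ultimately have "V \<subseteq> dual_class {1..n} P x" "x \<in> {1..n}"
      using x unfolding dual_class_def by auto
    then show "\<exists>Y\<in>dual {1..n} P. V \<subseteq> Y" unfolding dual_def by blast
  qed
  then show ex: "kreweras_compatible n P (dual {1..n} P) \<and>
    (\<forall>R. kreweras_compatible n P R \<longrightarrow> refines {1..n} R (dual {1..n} P))"
    using partition_on_dual noncrossing_interleave_dual[OF P] by (simp add: kreweras_compatible_def)
  fix Q assume "kreweras_compatible n P Q \<and> (\<forall>R. kreweras_compatible n P R \<longrightarrow> refines {1..n} R Q)"
  then show "Q = dual {1..n} P" using ex by (intro refines_asym[of "{1..n}"]) simp_all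
qed

lemma block_of_eq: "partition_on A P \<Longrightarrow> B \<in> P \<Longrightarrow> x \<in> B \<Longrightarrow> block_of P x = B"
proof -
  assume *: "partition_on A P" "B \<in> P" "x \<in> B"
  then have "{B \<in> P. x \<in> B} = {B}" using partition_on_unique[OF *(1)] by auto
  then show ?thesis by (simp add: block_of_def)
qed

lemma block_of_mem: "partition_on A P \<Longrightarrow> x \<in> A \<Longrightarrow> block_of P x \<in> P"
  by (metis UnionE block_of_eq partition_onD1)

lemma mem_block_of: "partition_on A P \<Longrightarrow> x \<in> A \<Longrightarrow> x \<in> block_of P x"
  by (metis UnionE block_of_eq partition_onD1)

lemma finite_ncp: "finite A \<Longrightarrow> finite (ncp A)"
  unfolding ncp_def by (rule finite_subset[OF _ finitely_many_partition_on[of A]]) auto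

section \<open>Partitions with the endpoints in one block\<close>

lemma insert_Un_absorb: "X \<subseteq> {e} \<Longrightarrow> insert e (X \<union> Y) = insert e Y"
  by blast

lemma noncrossing_subset:
  assumes "noncrossing P" "Q \<subseteq> P"
  shows "noncrossing Q"
proof (rule noncrossingI)
  fix B C i j k l
  assume "B \<in> Q" "C \<in> Q" "i \<in> B" "j \<in> C" "k \<in> B" "l \<in> C" "i < j" "j < k" "k < l"
  then show "B = C" using assms noncrossingD[of P B C i j k l] by (simp add: subsetD)
qed

text \<open>The block and the dual block of \<open>r\<close> are left out because their sizes still
  change when the partition is extended; \<open>root_gf\<close> records them separately.\<close>

definition weight :: "(nat \<Rightarrow> 'a::comm_semiring_1) \<Rightarrow> (nat \<Rightarrow> 'a) \<Rightarrow> nat set \<Rightarrow> nat \<Rightarrow> nat set set \<Rightarrow> 'a" where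
  "weight f g A r P = (\<Prod>B\<in>P - {block_of P r}. f (card B)) *
     (\<Prod>V\<in>dual A P - {dual_class A P r}. g (card V))"

text \<open>Undoes the deletion of \<open>a\<close> from a partition of [a, b] with a and b in one
  block.\<close>

definition cap :: "nat \<Rightarrow> nat \<Rightarrow> nat set set \<Rightarrow> nat set set" where
  "cap a b P = insert (insert a (block_of P b)) (P - {block_of P b})"

context
  fixes a b :: nat and P :: "nat set set"
  assumes ab: "a < b" and P: "P \<in> ncp {Suc a..b}"
begin

lemma cap_part: "partition_on {Suc a..b} P" and cap_nc: "noncrossing P"
  using P by (auto simp: ncp_def)

lemma cap_block: "block_of P b \<in> P" "b \<in> block_of P b" "block_of P b \<subseteq> {Suc a..b}" "a \<notin> block_of P b"
proof -
  have b: "b \<in> {Suc a..b}" using ab by simp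
  show *: "block_of P b \<in> P" "b \<in> block_of P b"
    using block_of_mem[OF cap_part b] mem_block_of[OF cap_part b] .
  show "block_of P b \<subseteq> {Suc a..b}" using * partition_onD1[OF cap_part] by blast
  then show "a \<notin> block_of P b" by auto
qed

lemma cap_mem_bounds: "C \<in> P \<Longrightarrow> u \<in> C \<Longrightarrow> Suc a \<le> u \<and> u \<le> b"
  using partition_onD1[OF cap_part] by (metis UnionI atLeastAtMost_iff)

lemma partition_on_cap: "partition_on {a..b} (cap a b P)"
proof -
  let ?B = "block_of P b"
  have disj: "disjnt ?B (\<Union>(P - {?B}))"
    using partition_on_unique[OF cap_part cap_block(1)] by (auto simp: disjnt_iff)
  have "insert ?B (P - {?B}) = P" using cap_block(1) by blast
  then have "partition_on ({Suc a..b} - ?B) (P - {?B})"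
    using partition_on_insert[OF disj, of "{Suc a..b}"] cap_part by simp
  moreover have "{Suc a..b} - ?B = {a..b} - insert a ?B" using cap_block(4) by auto
  moreover have "disjnt (insert a ?B) (\<Union>(P - {?B}))"
    using disj cap_mem_bounds[of _ a] by (auto simp: disjnt_iff)
  moreover have "insert a ?B \<subseteq> {a..b}"
    using cap_block(3) ab by (auto dest!: subsetD)
  ultimately show ?thesis
    unfolding cap_def using partition_on_insert[of "insert a ?B" "P - {?B}" "{a..b}"] by simp
qed

text \<open>In a crossing that uses the new point \<open>a\<close>, this point is leftmost;
  replacing it by \<open>b\<close> at the right end gives a crossing in P.\<close>

lemma noncrossing_cap: "noncrossing (cap a b P)"
proof (rule noncrossingI)
  let ?B = "block_of P b"
  fix X Y i j k l
  assume XY: "X \<in> cap a b P" "Y \<in> cap a b P" and m: "i \<in> X" "j \<in> Y" "k \<in> X" "l \<in> Y"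
    and less: "i < j" "j < k" "k < l"
  consider (1) "X \<in> P" "Y \<in> P" | (2) "X = insert a ?B" "Y = insert a ?B" |
    (3) "X = insert a ?B" "Y \<in> P" "Y \<noteq> ?B" | (4) "X \<in> P" "Y = insert a ?B" "X \<noteq> ?B"
    using XY unfolding cap_def by blast
  then show "X = Y"
  proof cases
    case 1
    then show ?thesis using noncrossingD[OF cap_nc 1 m less] by simp
  next
    case 2
    then show ?thesis by simp
  next
    case 3
    have "j > a" "l > a" "l \<le> b" using cap_mem_bounds[OF 3(2)] m by fastforce+
    then have k: "k \<in> ?B" using m 3 less by auto
    have "l \<noteq> b" using 3 m cap_block partition_on_unique[OF cap_part, of Y ?B l] by auto
    then have "l < b" using \<open>l \<le> b\<close> by simp
    then have "Y = ?B"
      using noncrossingD[OF cap_nc 3(2) cap_block(1) m(2) k m(4) cap_block(2)] less by simp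
    then show ?thesis using 3 by simp
  next
    case 4
    have "i > a" using cap_mem_bounds[OF 4(1)] m by fastforce
    then have "j \<in> ?B" "l \<in> ?B" using m 4 less by auto
    then have "X = ?B"
      using noncrossingD[OF cap_nc 4(1) cap_block(1) m(1) _ m(3)] less by blast
    then show ?thesis using 4 by simp
  qed
qed

lemma cap_ncp: "cap a b P \<in> ncp {a..b}"
  unfolding ncp_def using partition_on_cap noncrossing_cap by simp

lemma block_of_cap: "block_of (cap a b P) b = insert a (block_of P b)"
  by (rule block_of_eq[OF partition_on_cap]) (use cap_block in \<open>auto simp: cap_def\<close>)

lemma cap_minus_block: "cap a b P - {block_of (cap a b P) b} = P - {block_of P b}"
proof -
  have "insert a (block_of P b) \<notin> P" using cap_mem_bounds[of "insert a (block_of P b)" a] by auto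
  then show ?thesis unfolding block_of_cap by (auto simp: cap_def)
qed

section \<open>Cuts and dual classes of a capped partition\<close>

lemma same_cut_cap_b:
  assumes "x \<in> {a..<b}"
  shows "\<not> same_cut (cap a b P) x b"
proof
  assume "same_cut (cap a b P) x b"
  moreover have "insert a (block_of P b) \<in> cap a b P" by (simp add: cap_def)
  ultimately have "(a \<le> x \<and> x < b) \<longleftrightarrow> (a \<le> b \<and> b < b)"
    by (rule same_cutD) (use cap_block in auto)
  then show False using assms by simp
qed

text \<open>The only new pairs join \<open>a\<close> to some v in the block of \<open>b\<close>. If
  x and y differed on such a pair, exactly one of them would separate v from b in P.\<close>

lemma same_cut_cap:
  assumes x: "x \<in> {Suc a..<b}" and y: "y \<in> {Suc a..<b}"
  shows "same_cut (cap a b P) x y \<longleftrightarrow> same_cut P x y"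
proof
  assume *: "same_cut (cap a b P) x y"
  show "same_cut P x y"
  proof (rule same_cutI)
    fix C u v assume C: "C \<in> P" "u \<in> C" "v \<in> C"
    then obtain D where "D \<in> cap a b P" "C \<subseteq> D" unfolding cap_def by blast
    then show "(u \<le> x \<and> x < v) \<longleftrightarrow> (u \<le> y \<and> y < v)"
      using same_cutD[OF *] C by blast
  qed
next
  assume *: "same_cut P x y"
  have key: "y < v" if "same_cut P x y" "v \<in> block_of P b" "x < v" "y < b" for x y v
  proof (rule ccontr)
    assume "\<not> y < v"
    then have "v \<le> y \<and> y < b" using that by simp
    then show False
      using same_cutD[OF that(1) cap_block(1) that(2) cap_block(2)] that(3) by simp
  qed
  show "same_cut (cap a b P) x y"
  proof (rule same_cutI)
    fix C u v assume C: "C \<in> cap a b P" "u \<in> C" "v \<in> C"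
    consider (1) "C \<in> P" | (2) "C = insert a (block_of P b)" using C by (auto simp: cap_def)
    then show "(u \<le> x \<and> x < v) \<longleftrightarrow> (u \<le> y \<and> y < v)"
    proof cases
      case 1
      then show ?thesis using same_cutD[OF *] C by blast
    next
      case 2
      consider (v) "v = a" | (u) "u = a" "v \<in> block_of P b" | (uv) "u \<in> block_of P b" "v \<in> block_of P b"
        using C 2 by auto
      then show ?thesis
      proof cases
        case v
        then show ?thesis using x y by auto
      next
        case u
        have "x < v \<longleftrightarrow> y < v"
          using key[OF *] key[OF same_cut_sym[OF *]] u(2) x y by auto
        then show ?thesis using u(1) x y by auto
      next
        case uv
        then show ?thesis using same_cutD[OF * cap_block(1)] by blast
      qed
    qed
  qed
qed

text \<open>The cut after \<open>a\<close> separates \<open>a\<close> from the rest of its block and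
  nothing else; the cut after \<open>b\<close> separates nothing in P. A cut y < b that separates
  nothing in P lies before the whole block of \<open>b\<close>, so it agrees with the cut after
  \<open>a\<close>. Thus a' takes the place of b' in the dual class of b'.\<close>

lemma same_cut_cap_a:
  assumes y: "y \<in> {Suc a..<b}"
  shows "same_cut (cap a b P) a y \<longleftrightarrow> same_cut P b y"
proof
  assume *: "same_cut (cap a b P) a y"
  show "same_cut P b y"
  proof (rule same_cutI)
    fix C u v assume C: "C \<in> P" "u \<in> C" "v \<in> C"
    have "\<not> (u \<le> y \<and> y < v)"
    proof (cases "C = block_of P b")
      case True
      have "(a \<le> a \<and> a < u) \<longleftrightarrow> (a \<le> y \<and> y < u)"
        by (rule same_cutD[OF *, of "insert a (block_of P b)"]) (use C True in \<open>auto simp: cap_def\<close>)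
      then show ?thesis using cap_mem_bounds[OF C(1,2)] by auto
    next
      case False
      then have "C \<in> cap a b P" using C by (simp add: cap_def)
      then show ?thesis using same_cutD[OF * _ C(2,3)] cap_mem_bounds[OF C(1,2)] by auto
    qed
    then show "(u \<le> b \<and> b < v) \<longleftrightarrow> (u \<le> y \<and> y < v)" using cap_mem_bounds[OF C(1,3)] by auto
  qed
next
  assume "same_cut P b y"
  then have *: "\<not> (u \<le> y \<and> y < v)" if "C \<in> P" "u \<in> C" "v \<in> C" for C u v
    using same_cutD[of P b y C u v] cap_mem_bounds[of C v] that by auto
  show "same_cut (cap a b P) a y"
  proof (rule same_cutI)
    fix C u v assume C: "C \<in> cap a b P" "u \<in> C" "v \<in> C"
    consider (1) "C \<in> P" | (2) "C = insert a (block_of P b)" using C by (auto simp: cap_def)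
    then show "(u \<le> a \<and> a < v) \<longleftrightarrow> (u \<le> y \<and> y < v)"
    proof cases
      case 1
      then show ?thesis using *[OF 1] cap_mem_bounds[OF 1] C by fastforce
    next
      case 2
      consider (v) "v = a" | (u) "u = a" "v \<in> block_of P b" | (uv) "u \<in> block_of P b" "v \<in> block_of P b"
        using C 2 by auto
      then show ?thesis
      proof cases
        case v
        then show ?thesis using y by auto
      next
        case u
        then have "y < v" "a < v"
          using *[OF cap_block(1) u(2) cap_block(2)] y cap_mem_bounds[OF cap_block(1) u(2)] by auto
        then show ?thesis using u(1) y by auto
      next
        case uv
        then show ?thesis using *[OF cap_block(1) uv] cap_mem_bounds[OF cap_block(1) uv(1)] by auto
      qed
    qed
  qed
qed

lemma dual_class_cap_b: "dual_class {a..b} (cap a b P) b = {b}"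
proof -
  have "y = b" if "y \<in> {a..b}" "same_cut (cap a b P) b y" for y
    using same_cut_cap_b[of y] same_cut_sym[OF that(2)] that(1) by fastforce
  then show ?thesis using ab by (auto simp: dual_class_def)
qed

lemma dual_class_cap_a:
  "dual_class {a..b} (cap a b P) a = insert a (dual_class {Suc a..b} P b - {b})"
proof -
  have "y \<in> dual_class {a..b} (cap a b P) a \<longleftrightarrow> y \<in> insert a (dual_class {Suc a..b} P b - {b})" for y
  proof -
    consider "y = a" | "y \<in> {Suc a..<b}" | "y = b" | "y \<notin> {a..b}" using ab by fastforce
    then show ?thesis
      by cases (use same_cut_cap_a same_cut_cap_b[of a] ab in \<open>auto simp: dual_class_def\<close>)
  qed
  then show ?thesis by blast
qed

lemma dual_class_cap:
  assumes x: "x \<in> {Suc a..<b}" "x \<notin> dual_class {Suc a..b} P b"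
  shows "dual_class {a..b} (cap a b P) x = dual_class {Suc a..b} P x"
proof -
  have xb: "\<not> same_cut P b x" using x by (auto simp: dual_class_def)
  have "y \<in> dual_class {a..b} (cap a b P) x \<longleftrightarrow> y \<in> dual_class {Suc a..b} P x" for y
  proof -
    consider "y = a" | "y \<in> {Suc a..<b}" | "y = b" | "y \<notin> {a..b}" using ab by fastforce
    then show ?thesis
    proof cases
      case 1
      then show ?thesis using xb same_cut_cap_a[OF x(1)] same_cut_sym by (auto simp: dual_class_def)
    next
      case 2
      then show ?thesis using same_cut_cap[OF x(1) 2] by (auto simp: dual_class_def)
    next
      case 3
      then show ?thesis using xb same_cut_sym same_cut_cap_b[of x] x by (auto simp: dual_class_def)
    qed (auto simp: dual_class_def)
  qed
  then show ?thesis by blast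
qed

lemma dual_cap:
  "dual {a..b} (cap a b P) - {dual_class {a..b} (cap a b P) b} =
    insert (insert a (dual_class {Suc a..b} P b - {b})) (dual {Suc a..b} P - {dual_class {Suc a..b} P b})"
    (is "?L = insert ?E ?R")
proof -
  let ?D = "dual_class {Suc a..b} P b"
  let ?I = "{x \<in> {Suc a..<b}. x \<notin> ?D}"
  have same_D: "dual_class {Suc a..b} P x = ?D \<longleftrightarrow> x \<in> ?D" if "x \<in> {Suc a..b}" for x
    using that dual_class_eq[of P b x] by (auto simp: dual_class_def)
  have in_D: "dual_class {a..b} (cap a b P) x = ?E" if "x \<in> {Suc a..<b}" "x \<in> ?D" for x
    using that dual_class_cap_a dual_class_eq[of "cap a b P" a x] same_cut_cap_a[of x]
    by (auto simp: dual_class_def)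
  \<comment> \<open>Points of the old dual class of \<open>b\<close> now lie in the class of
    \<open>a\<close>, so they add nothing to the image.\<close>
  have "{a..b} = insert b (insert a ({x \<in> {Suc a..<b}. x \<in> ?D} \<union> ?I))" using ab by auto
  then have "dual {a..b} (cap a b P) = insert {b} (insert ?E (dual_class {Suc a..b} P ` ?I))"
  proof -
    assume eq: "{a..b} = insert b (insert a ({x \<in> {Suc a..<b}. x \<in> ?D} \<union> ?I))"
    have "dual_class {a..b} (cap a b P) ` ?I = dual_class {Suc a..b} P ` ?I"
      by (intro image_cong refl dual_class_cap) simp_all
    moreover have "dual_class {a..b} (cap a b P) ` {x \<in> {Suc a..<b}. x \<in> ?D} \<subseteq> {?E}"
      using in_D by blast
    then have "insert ?E (dual_class {a..b} (cap a b P) ` {x \<in> {Suc a..<b}. x \<in> ?D} \<union> Y) = insert ?E Y" for Y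
      by (rule insert_Un_absorb)
    moreover have "dual {a..b} (cap a b P) = insert {b} (insert ?E
      (dual_class {a..b} (cap a b P) ` {x \<in> {Suc a..<b}. x \<in> ?D} \<union> dual_class {a..b} (cap a b P) ` ?I))"
      unfolding dual_def
      by (subst (2) eq) (simp only: image_insert image_Un dual_class_cap_a dual_class_cap_b)
    ultimately show ?thesis by simp
  qed
  moreover have "dual_class {Suc a..b} P ` ?I = ?R"
  proof -
    have "{x \<in> {Suc a..b}. x \<notin> ?D} = ?I" using ab by (auto simp: dual_class_def order_le_less)
    then have "?I = {x \<in> {Suc a..b}. dual_class {Suc a..b} P x \<noteq> ?D}"
      using same_D by (simp cong: conj_cong)
    then show ?thesis unfolding dual_def by blast
  qed
  moreover have "{b} \<noteq> ?E" using ab by auto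
  moreover have "{b} \<notin> ?R"
  proof
    assume "{b} \<in> ?R"
    moreover have "?D \<in> dual {Suc a..b} P" "b \<in> ?D" using ab by (auto simp: dual_def dual_class_def)
    ultimately show False
      using partition_on_unique[OF partition_on_dual, of "{b}" "{Suc a..b}" P ?D b] by blast
  qed
  ultimately have "dual {a..b} (cap a b P) = insert {b} (insert ?E ?R)" "{b} \<notin> insert ?E ?R"
    by simp_all
  then show ?thesis unfolding dual_class_cap_b using Diff_insert_absorb by metis
qed

text \<open>The old root class, with \<open>a\<close> in place of \<open>b\<close>, keeps its size
  but is no longer rooted; this gives the factor. The unrooted blocks do not change.\<close>

lemma weight_cap:
  "weight f g {a..b} b (cap a b P) =
    g (card (dual_class {Suc a..b} P b)) * weight f g {Suc a..b} b P"
proof -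
  let ?D = "dual_class {Suc a..b} P b"
  have D: "finite ?D" "b \<in> ?D" "a \<notin> ?D" using ab by (auto simp: dual_class_def)
  have "card (insert a (?D - {b})) = card ?D"
    using D by (metis Diff_iff card_Suc_Diff1 card_insert_disjoint finite_Diff)
  moreover have "insert a (?D - {b}) \<notin> dual {Suc a..b} P"
    using partition_onD1[OF partition_on_dual[of "{Suc a..b}" P]]
    by (metis UnionI atLeastAtMost_iff insertI1 not_less_eq_eq order_refl)
  moreover have "finite (dual {Suc a..b} P)" by (simp add: dual_def)
  ultimately show ?thesis
    unfolding weight_def dual_cap cap_minus_block by (simp add: mult_ac)
qed

lemma card_block_of_cap: "card (block_of (cap a b P) b) = Suc (card (block_of P b))"
  unfolding block_of_cap using cap_block(3,4) by (simp add: finite_subset[OF cap_block(3)])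

lemma uncap_cap: "insert (block_of (cap a b P) b - {a}) (cap a b P - {block_of (cap a b P) b}) = P"
  unfolding cap_minus_block unfolding block_of_cap using cap_block(1,4) by (simp add: insert_absorb)

end

text \<open>Deleting \<open>a\<close> leaves the root block nonempty, since \<open>b\<close> stays
  in it.\<close>

lemma uncap:
  assumes "a < b" and Q: "Q \<in> ncp {a..b}" and a: "a \<in> block_of Q b"
  defines "P \<equiv> insert (block_of Q b - {a}) (Q - {block_of Q b})"
  shows "P \<in> ncp {Suc a..b}" "cap a b P = Q"
proof -
  let ?X = "block_of Q b"
  have part: "partition_on {a..b} Q" and nc: "noncrossing Q" using Q by (auto simp: ncp_def)
  have X: "?X \<in> Q" "b \<in> ?X" using block_of_mem[OF part] mem_block_of[OF part] assms(1) by auto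
  have disj: "disjnt ?X (\<Union>(Q - {?X}))"
    using partition_on_unique[OF part X(1)] by (auto simp: disjnt_iff)
  have "insert ?X (Q - {?X}) = Q" using X by blast
  then have "partition_on ({a..b} - ?X) (Q - {?X})" "?X \<subseteq> {a..b}"
    using partition_on_insert[OF disj, of "{a..b}"] part by simp_all
  moreover have "{a..b} - ?X = {Suc a..b} - (?X - {a})" using a by (auto simp: Suc_le_eq order_le_less)
  moreover have "disjnt (?X - {a}) (\<Union>(Q - {?X}))" using disj by (auto simp: disjnt_iff)
  moreover have "?X - {a} \<subseteq> {Suc a..b}"
  proof
    fix x assume "x \<in> ?X - {a}"
    then have "x \<in> {a..b}" "x \<noteq> a" using \<open>?X \<subseteq> {a..b}\<close> by blast+
    then show "x \<in> {Suc a..b}" by simp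
  qed
  moreover have "?X - {a} \<noteq> {}" using X(2) assms(1) by blast
  ultimately have partP: "partition_on {Suc a..b} P"
    unfolding P_def using partition_on_insert[of "?X - {a}" "Q - {?X}" "{Suc a..b}"] by simp
  moreover have "noncrossing P"
  proof (rule noncrossingI)
    fix B C i j k l
    assume *: "B \<in> P" "C \<in> P" "i \<in> B" "j \<in> C" "k \<in> B" "l \<in> C" "i < j" "j < k" "k < l"
    \<comment> \<open>As \<open>a\<close> lies only in the root block, each block of P is a block of
      Q with \<open>a\<close> removed.\<close>
    obtain B' where B': "B' \<in> Q" "B \<subseteq> B'" "B = B' - {a}" using *(1) a disj X unfolding P_def disjnt_iff by blast
    obtain C' where C': "C' \<in> Q" "C \<subseteq> C'" "C = C' - {a}" using *(2) a disj X unfolding P_def disjnt_iff by blast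
    have "B' = C'" using noncrossingD[OF nc B'(1) C'(1), of i j k l] * B' C' by blast
    then show "B = C" using B' C' by simp
  qed
  ultimately show "P \<in> ncp {Suc a..b}" by (simp add: ncp_def)
  have "block_of P b = ?X - {a}"
    using X assms(1) by (intro block_of_eq[OF partP]) (auto simp: P_def)
  moreover have "?X - {a} \<notin> Q"
    using partition_on_unique[OF part _ X(1), of "?X - {a}" b] X a assms(1) by auto
  ultimately show "cap a b P = Q"
    unfolding cap_def using a X(1) by (auto simp: P_def insert_absorb)
qed

lemma bij_betw_cap:
  assumes "a < b"
  shows "bij_betw (cap a b) (ncp {Suc a..b}) {Q \<in> ncp {a..b}. a \<in> block_of Q b}"
proof (rule bij_betw_byWitness[where f' = "\<lambda>Q. insert (block_of Q b - {a}) (Q - {block_of Q b})"])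
  show "\<forall>P\<in>ncp {Suc a..b}. insert (block_of (cap a b P) b - {a}) (cap a b P - {block_of (cap a b P) b}) = P"
    using uncap_cap[OF assms] by blast
  show "\<forall>Q\<in>{Q \<in> ncp {a..b}. a \<in> block_of Q b}. cap a b (insert (block_of Q b - {a}) (Q - {block_of Q b})) = Q"
    using uncap(2)[OF assms] by blast
  show "cap a b ` ncp {Suc a..b} \<subseteq> {Q \<in> ncp {a..b}. a \<in> block_of Q b}"
    using cap_ncp[OF assms] block_of_cap[OF assms] by auto
  show "(\<lambda>Q. insert (block_of Q b - {a}) (Q - {block_of Q b})) ` {Q \<in> ncp {a..b}. a \<in> block_of Q b} \<subseteq> ncp {Suc a..b}"
    using uncap(1)[OF assms] by blast
qed

section \<open>Partitions with the endpoints in different blocks\<close>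

context
  fixes a l b :: nat and P Q :: "nat set set"
  assumes lb: "a \<le> l" "l < b" and P: "P \<in> ncp {a..l}" and aP: "a \<in> block_of P l"
    and Q: "Q \<in> ncp {Suc l..b}"
begin

lemma glue_part: "partition_on {a..l} P" "partition_on {Suc l..b} Q"
  and glue_nc: "noncrossing P" "noncrossing Q"
  using P Q by (auto simp: ncp_def)

lemma glue_left_bounds: "C \<in> P \<Longrightarrow> u \<in> C \<Longrightarrow> a \<le> u \<and> u \<le> l"
  using partition_onD1[OF glue_part(1)] by (metis UnionI atLeastAtMost_iff)

lemma glue_right_bounds: "C \<in> Q \<Longrightarrow> u \<in> C \<Longrightarrow> Suc l \<le> u \<and> u \<le> b"
  using partition_onD1[OF glue_part(2)] by (metis UnionI atLeastAtMost_iff)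

lemma glue_block: "block_of P l \<in> P" "l \<in> block_of P l"
  using block_of_mem[OF glue_part(1), of l] mem_block_of[OF glue_part(1), of l] lb by simp_all

lemma partition_on_glue: "partition_on {a..b} (P \<union> Q)"
proof (rule partition_onI)
  have "{a..l} \<union> {Suc l..b} = {a..b}" using lb by auto
  then show "\<Union> (P \<union> Q) = {a..b}"
    using partition_onD1[OF glue_part(1)] partition_onD1[OF glue_part(2)] by (metis Union_Un_distrib)
  show "{} \<notin> P \<union> Q"
    using partition_onD3[OF glue_part(1)] partition_onD3[OF glue_part(2)] by simp
  fix B C assume BC: "B \<in> P \<union> Q" "C \<in> P \<union> Q" "B \<noteq> C"
  show "disjnt B C"
    unfolding disjnt_iff
  proof (intro allI notI)
    fix x assume x: "x \<in> B \<and> x \<in> C"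
    consider "B \<in> P" "C \<in> P" | "B \<in> Q" "C \<in> Q" | "B \<in> P" "C \<in> Q" | "B \<in> Q" "C \<in> P"
      using BC by blast
    then show False
    proof cases
      case 1
      then show ?thesis using partition_on_unique[OF glue_part(1) 1, of x] x BC by simp
    next
      case 2
      then show ?thesis using partition_on_unique[OF glue_part(2) 2, of x] x BC by simp
    next
      case 3
      then show ?thesis using glue_left_bounds[OF 3(1), of x] glue_right_bounds[OF 3(2), of x] x by simp
    next
      case 4
      then show ?thesis using glue_left_bounds[OF 4(2), of x] glue_right_bounds[OF 4(1), of x] x by simp
    qed
  qed
qed

lemma glue_ncp: "P \<union> Q \<in> ncp {a..b}"
proof -
  have "noncrossing (P \<union> Q)"
  proof (rule noncrossingI)
    fix B C i j k m
    assume BC: "B \<in> P \<union> Q" "C \<in> P \<union> Q" and m: "i \<in> B" "j \<in> C" "k \<in> B" "m \<in> C"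
      and less: "i < j" "j < k" "k < m"
    consider "B \<in> P" "C \<in> P" | "B \<in> Q" "C \<in> Q" | "B \<in> P" "C \<in> Q" | "B \<in> Q" "C \<in> P"
      using BC by blast
    then show "B = C"
    proof cases
      case 1
      then show ?thesis using noncrossingD[OF glue_nc(1) 1 m less] by simp
    next
      case 2
      then show ?thesis using noncrossingD[OF glue_nc(2) 2 m less] by simp
    next
      case 3
      then show ?thesis using glue_left_bounds[OF 3(1) m(3)] glue_right_bounds[OF 3(2) m(2)] less by simp
    next
      case 4
      then show ?thesis using glue_left_bounds[OF 4(2) m(2)] glue_right_bounds[OF 4(1) m(1)] less by simp
    qed
  qed
  then show ?thesis using partition_on_glue by (simp add: ncp_def)
qed

lemma block_of_glue_b: "block_of (P \<union> Q) b = block_of Q b" "block_of Q b \<in> Q"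
proof -
  have b: "b \<in> {Suc l..b}" using lb by simp
  show "block_of Q b \<in> Q" using block_of_mem[OF glue_part(2) b] .
  then show "block_of (P \<union> Q) b = block_of Q b"
    using mem_block_of[OF glue_part(2) b] by (intro block_of_eq[OF partition_on_glue]) simp_all
qed

lemma block_of_glue_a: "block_of (P \<union> Q) a = block_of P l"
  using glue_block aP by (intro block_of_eq[OF partition_on_glue]) simp_all

lemma a_notin_block_of_glue: "a \<notin> block_of (P \<union> Q) b"
  unfolding block_of_glue_b using glue_right_bounds[OF block_of_glue_b(2), of a] lb by auto

text \<open>Recovers the splitting point from the union; together with \<open>glue_restrict\<close>
  this makes gluing injective.\<close>

lemma Max_block_of_glue: "Max (block_of (P \<union> Q) a) = l"
  unfolding block_of_glue_a
proof (rule Max_eqI)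
  show "finite (block_of P l)"
    by (rule finite_subset[of _ "{a..l}"]) (use glue_left_bounds[OF glue_block(1)] in auto)
qed (use glue_left_bounds[OF glue_block(1)] glue_block in auto)

lemma glue_restrict: "{C \<in> P \<union> Q. C \<subseteq> {a..l}} = P" "{C \<in> P \<union> Q. C \<subseteq> {Suc l..b}} = Q"
proof -
  have P_sub: "C \<subseteq> {a..l}" if "C \<in> P" for C using glue_left_bounds[OF that] by auto
  have Q_sub: "C \<subseteq> {Suc l..b}" if "C \<in> Q" for C using glue_right_bounds[OF that] by auto
  have not_both: False if "C \<in> P \<union> Q" "C \<subseteq> {a..l}" "C \<subseteq> {Suc l..b}" for C
  proof -
    have "C \<noteq> {}" using that(1) partition_onD3[OF partition_on_glue] by metis
    then obtain x where "x \<in> C" by blast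
    then have "x \<in> {a..l}" "x \<in> {Suc l..b}" using that by blast+
    then show False by simp
  qed
  have "C \<in> P \<union> Q \<and> C \<subseteq> {a..l} \<longleftrightarrow> C \<in> P" for C
    using P_sub[of C] Q_sub[of C] not_both[of C] by (cases "C \<in> P"; cases "C \<in> Q") auto
  then show "{C \<in> P \<union> Q. C \<subseteq> {a..l}} = P" by (intro set_eqI) (simp only: mem_Collect_eq)
  have "C \<in> P \<union> Q \<and> C \<subseteq> {Suc l..b} \<longleftrightarrow> C \<in> Q" for C
    using P_sub[of C] Q_sub[of C] not_both[of C] by (cases "C \<in> P"; cases "C \<in> Q") auto
  then show "{C \<in> P \<union> Q. C \<subseteq> {Suc l..b}} = Q" by (intro set_eqI) (simp only: mem_Collect_eq)
qed

section \<open>Cuts and dual classes of a glued partition\<close>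

lemma same_cut_glue_P:
  assumes "x < l" "y < l"
  shows "same_cut (P \<union> Q) x y \<longleftrightarrow> same_cut P x y"
proof
  assume *: "same_cut (P \<union> Q) x y"
  show "same_cut P x y" by (rule same_cutI, rule same_cutD[OF *]) auto
next
  assume *: "same_cut P x y"
  show "same_cut (P \<union> Q) x y"
  proof (rule same_cutI)
    fix C u v assume C: "C \<in> P \<union> Q" "u \<in> C" "v \<in> C"
    show "(u \<le> x \<and> x < v) \<longleftrightarrow> (u \<le> y \<and> y < v)"
    proof (cases "C \<in> P")
      case True
      then show ?thesis using same_cutD[OF *] C by blast
    next
      case False
      then show ?thesis using glue_right_bounds[of C u] C assms by auto
    qed
  qed
qed

text \<open>Cuts at or after \<open>l\<close> separate no pair of P. The bound includes l, whose
  dual point belongs with the right part.\<close>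

lemma same_cut_glue_Q:
  assumes "l \<le> x" "l \<le> y"
  shows "same_cut (P \<union> Q) x y \<longleftrightarrow> same_cut Q x y"
proof
  assume *: "same_cut (P \<union> Q) x y"
  show "same_cut Q x y" by (rule same_cutI, rule same_cutD[OF *]) auto
next
  assume *: "same_cut Q x y"
  show "same_cut (P \<union> Q) x y"
  proof (rule same_cutI)
    fix C u v assume C: "C \<in> P \<union> Q" "u \<in> C" "v \<in> C"
    show "(u \<le> x \<and> x < v) \<longleftrightarrow> (u \<le> y \<and> y < v)"
    proof (cases "C \<in> Q")
      case True
      then show ?thesis using same_cutD[OF *] C by blast
    next
      case False
      then show ?thesis using glue_left_bounds[of C v] C assms by auto
    qed
  qed
qed

text \<open>The pair a, l lies in one block of P and tells the two kinds of cut apart.\<close>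

lemma same_cut_glue_PQ:
  assumes "a \<le> x" "x < l" "l \<le> y"
  shows "\<not> same_cut (P \<union> Q) x y" "\<not> same_cut (P \<union> Q) y x"
proof -
  show *: "\<not> same_cut (P \<union> Q) x y"
  proof
    assume "same_cut (P \<union> Q) x y"
    then have "(a \<le> x \<and> x < l) \<longleftrightarrow> (a \<le> y \<and> y < l)"
      by (rule same_cutD) (use glue_block aP in auto)
    then show False using assms by simp
  qed
  then show "\<not> same_cut (P \<union> Q) y x" using same_cut_sym by blast
qed

lemma same_cut_P_l:
  assumes "a \<le> x" "x < l"
  shows "\<not> same_cut P x l" "\<not> same_cut P l x"
proof -
  show *: "\<not> same_cut P x l"
  proof
    assume "same_cut P x l"
    then have "(a \<le> x \<and> x < l) \<longleftrightarrow> (a \<le> l \<and> l < l)"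
      by (rule same_cutD) (use glue_block aP in auto)
    then show False using assms by simp
  qed
  then show "\<not> same_cut P l x" using same_cut_sym by blast
qed

text \<open>Neither cut has points of Q on both sides. This is why l' joins the dual class of
  b'.\<close>

lemma same_cut_Q_l: "same_cut Q l b"
proof (rule same_cutI)
  fix C u v assume "C \<in> Q" "u \<in> C" "v \<in> C"
  then show "(u \<le> l \<and> l < v) \<longleftrightarrow> (u \<le> b \<and> b < v)"
    using glue_right_bounds[of C u] glue_right_bounds[of C v] by auto
qed

lemma dual_class_glue_P:
  assumes x: "x \<in> {a..<l}"
  shows "dual_class {a..b} (P \<union> Q) x = dual_class {a..l} P x"
proof -
  have "y \<in> dual_class {a..b} (P \<union> Q) x \<longleftrightarrow> y \<in> dual_class {a..l} P x" for y
  proof (cases "y < l")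
    case True
    then show ?thesis using same_cut_glue_P[of x y] x lb by (auto simp: dual_class_def)
  next
    case False
    then have "y = l \<or> l < y" by auto
    then show ?thesis using same_cut_glue_PQ(1)[of x y] same_cut_P_l(1)[of x] x
      by (auto simp: dual_class_def)
  qed
  then show ?thesis by blast
qed

lemma dual_class_P_l: "dual_class {a..l} P l = {l}"
proof -
  have "y = l" if "y \<in> {a..l}" "same_cut P l y" for y
    using that same_cut_P_l(2)[of y] by (cases "y < l") auto
  then show ?thesis using lb by (auto simp: dual_class_def)
qed

lemma dual_class_glue_Q:
  assumes x: "x \<in> {l..b}"
  shows "dual_class {a..b} (P \<union> Q) x =
    (if same_cut Q x b then insert l (dual_class {Suc l..b} Q b) else dual_class {Suc l..b} Q x)"
proof -
  have *: "same_cut Q x y \<longleftrightarrow> same_cut Q b y" if "same_cut Q x b" for y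
    using that same_cut_sym same_cut_trans by metis
  have **: "\<not> same_cut Q x l" if "\<not> same_cut Q x b"
    using that same_cut_Q_l same_cut_trans by metis
  have "y \<in> dual_class {a..b} (P \<union> Q) x \<longleftrightarrow>
    y \<in> (if same_cut Q x b then insert l (dual_class {Suc l..b} Q b) else dual_class {Suc l..b} Q x)" for y
  proof -
    consider (1) "y < l" | (2) "y = l" | (3) "Suc l \<le> y" by linarith
    then show ?thesis
    proof cases
      case 1
      then show ?thesis using same_cut_glue_PQ(2)[of y x] x by (auto simp: dual_class_def)
    next
      case 2
      then show ?thesis
        using same_cut_glue_Q[of x l] ** *[of l] same_cut_sym[OF same_cut_Q_l] x lb by (auto simp: dual_class_def)
    next
      case 3
      then show ?thesis using same_cut_glue_Q[of x y] *[of y] x lb by (auto simp: dual_class_def)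
    qed
  qed
  then show ?thesis by blast
qed

lemma dual_class_glue_b:
  "dual_class {a..b} (P \<union> Q) b = insert l (dual_class {Suc l..b} Q b)"
  using dual_class_glue_Q[of b] lb by simp

lemma card_dual_class_glue_b:
  "card (dual_class {a..b} (P \<union> Q) b) = Suc (card (dual_class {Suc l..b} Q b))"
  unfolding dual_class_glue_b by (simp add: dual_class_def)

text \<open>The root class {l} of P is absorbed by the root class of Q; cuts before \<open>l\<close>
  keep their classes from P, and those after \<open>l\<close> outside the root class keep theirs
  from Q.\<close>

lemma dual_glue:
  "dual {a..b} (P \<union> Q) - {dual_class {a..b} (P \<union> Q) b} =
    (dual {a..l} P - {dual_class {a..l} P l}) \<union> (dual {Suc l..b} Q - {dual_class {Suc l..b} Q b})"
proof -
  let ?d = "dual_class {a..b} (P \<union> Q)" and ?e = "dual_class {Suc l..b} Q" and ?c = "dual_class {a..l} P"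
  let ?J = "{x \<in> {Suc l..b}. \<not> same_cut Q x b}"
  have same_P: "?c x \<noteq> ?c l" if "x \<in> {a..<l}" for x
  proof -
    have "x \<in> ?c x" "x \<notin> ?c l" using that unfolding dual_class_P_l by (simp_all add: dual_class_def)
    then show ?thesis by blast
  qed
  have same_Q: "?e x \<noteq> ?e b \<longleftrightarrow> \<not> same_cut Q x b" if "x \<in> {Suc l..b}" for x
  proof -
    have "b \<in> ?e b" using lb by (simp add: dual_class_def)
    moreover have "b \<in> ?e x \<Longrightarrow> same_cut Q x b" by (simp add: dual_class_def)
    ultimately show ?thesis using dual_class_eq[of Q x b] by blast
  qed
  have same_d: "?d x \<noteq> ?d b \<longleftrightarrow> x \<in> {a..<l} \<union> ?J" if "x \<in> {a..b}" for x
  proof -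
    have "b \<in> ?d b" using lb by (simp add: dual_class_def)
    moreover have "b \<in> ?d x \<Longrightarrow> same_cut (P \<union> Q) x b" by (simp add: dual_class_def)
    ultimately have "?d x = ?d b \<longleftrightarrow> same_cut (P \<union> Q) x b"
      using dual_class_eq[of "P \<union> Q" x b] by blast
    moreover have "same_cut (P \<union> Q) x b \<longleftrightarrow> x \<notin> {a..<l} \<union> ?J"
    proof -
      consider (1) "x < l" | (2) "x = l" | (3) "Suc l \<le> x" by linarith
      then show ?thesis
        by cases (use same_cut_glue_PQ(1)[of x b] same_cut_glue_Q[of x b] same_cut_Q_l lb that in auto)
    qed
    ultimately show ?thesis by (simp only: not_not)
  qed
  have "dual {a..b} (P \<union> Q) - {?d b} = ?d ` {x \<in> {a..b}. ?d x \<noteq> ?d b}"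
    unfolding dual_def by blast
  also have "{x \<in> {a..b}. ?d x \<noteq> ?d b} = {x \<in> {a..b}. x \<in> {a..<l} \<union> ?J}"
    by (rule Collect_cong) (use same_d in blast)
  also have "\<dots> = {a..<l} \<union> ?J" using lb by auto
  also have "?d ` \<dots> = ?d ` {a..<l} \<union> ?d ` ?J" by (rule image_Un)
  also have "?d ` {a..<l} = ?c ` {a..<l}"
    by (intro image_cong refl dual_class_glue_P)
  also have "\<dots> = ?c ` {x \<in> {a..l}. ?c x \<noteq> ?c l}"
  proof -
    have "x \<in> {a..<l} \<longleftrightarrow> x \<in> {a..l} \<and> ?c x \<noteq> ?c l" for x
    proof
      show "x \<in> {a..<l} \<Longrightarrow> x \<in> {a..l} \<and> ?c x \<noteq> ?c l" using same_P[of x] by simp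
      assume x: "x \<in> {a..l} \<and> ?c x \<noteq> ?c l"
      then have "x \<noteq> l" by blast
      then show "x \<in> {a..<l}" using x by simp
    qed
    then have "{a..<l} = {x \<in> {a..l}. ?c x \<noteq> ?c l}" by (intro set_eqI) (simp only: mem_Collect_eq)
    then show ?thesis by simp
  qed
  also have "\<dots> = dual {a..l} P - {?c l}" unfolding dual_def by blast
  also have "?d ` ?J = ?e ` ?J"
    by (intro image_cong refl) (simp add: dual_class_glue_Q)
  also have "?J = {x \<in> {Suc l..b}. ?e x \<noteq> ?e b}" using same_Q by blast
  also have "?e ` \<dots> = dual {Suc l..b} Q - {?e b}" unfolding dual_def by blast
  finally show ?thesis .
qed

text \<open>The root block of P becomes unrooted and contributes a factor f. Its dual root {l}
  merges into the new dual root, so no factor g arises.\<close>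

lemma weight_glue:
  "weight f g {a..b} b (P \<union> Q) =
    f (card (block_of P l)) * weight f g {a..l} l P * weight f g {Suc l..b} b Q"
proof -
  let ?B = "block_of P l" and ?C = "block_of Q b"
  let ?c = "dual_class {a..l} P l" and ?e = "dual_class {Suc l..b} Q b"
  have fin: "finite P" "finite Q"
    using glue_part finite_elements finite_atLeastAtMost by blast+
  have notP: "C \<notin> P" if "C \<in> Q" for C
  proof
    assume "C \<in> P"
    moreover have "C \<noteq> {}" using partition_onD3[OF glue_part(2)] that by metis
    then obtain x where "x \<in> C" by blast
    ultimately show False using glue_left_bounds[of C x] glue_right_bounds[of C x] that by simp
  qed
  then have "P \<union> Q - {?C} = P \<union> (Q - {?C})" using block_of_glue_b(2) by blast
  then have "(\<Prod>B\<in>P \<union> Q - {block_of (P \<union> Q) b}. f (card B)) =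
      (\<Prod>B\<in>P \<union> (Q - {?C}). f (card B))"
    by (simp add: block_of_glue_b)
  also have "\<dots> = (\<Prod>B\<in>P. f (card B)) * (\<Prod>B\<in>Q - {?C}. f (card B))"
    using fin notP by (intro prod.union_disjoint) auto
  also have "(\<Prod>B\<in>P. f (card B)) = f (card ?B) * (\<Prod>B\<in>P - {?B}. f (card B))"
    by (rule prod.remove[OF fin(1) glue_block(1)])
  finally have 1: "(\<Prod>B\<in>P \<union> Q - {block_of (P \<union> Q) b}. f (card B)) =
    f (card ?B) * (\<Prod>B\<in>P - {?B}. f (card B)) * (\<Prod>B\<in>Q - {?C}. f (card B))" .
  have "(dual {a..l} P - {?c}) \<inter> (dual {Suc l..b} Q - {?e}) = {}"
  proof -
    have False if "V \<in> dual {a..l} P" "V \<in> dual {Suc l..b} Q" for V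
    proof -
      have "V \<noteq> {}" using partition_onD3[OF partition_on_dual] that(1) by metis
      then obtain x where "x \<in> V" by blast
      then have "x \<in> {a..l}" "x \<in> {Suc l..b}"
        using that partition_onD1[OF partition_on_dual] by (metis UnionI)+
      then show False by simp
    qed
    then show ?thesis by blast
  qed
  moreover have "finite (dual {a..l} P)" "finite (dual {Suc l..b} Q)" by (simp_all add: dual_def)
  ultimately have 2: "(\<Prod>V\<in>dual {a..b} (P \<union> Q) - {dual_class {a..b} (P \<union> Q) b}. g (card V)) =
    (\<Prod>V\<in>dual {a..l} P - {?c}. g (card V)) * (\<Prod>V\<in>dual {Suc l..b} Q - {?e}. g (card V))"
    unfolding dual_glue by (intro prod.union_disjoint) auto
  show ?thesis unfolding weight_def 1 2 by (simp add: mult_ac)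
qed

end

text \<open>No other block has points u < l < v, since a < u < l < v would be a crossing with the
  block of \<open>a\<close>. So every block lies on one side of the cut after l.\<close>

lemma unglue:
  assumes R: "R \<in> ncp {a..b}" and ab: "a \<le> b" and a: "a \<notin> block_of R b"
  defines "l \<equiv> Max (block_of R a)"
  obtains P Q where "a \<le> l" "l < b" "P \<in> ncp {a..l}" "a \<in> block_of P l" "Q \<in> ncp {Suc l..b}" "R = P \<union> Q"
proof -
  let ?B = "block_of R a"
  define P where "P = {C \<in> R. C \<subseteq> {a..l}}"
  define Q where "Q = {C \<in> R. C \<subseteq> {Suc l..b}}"
  have part: "partition_on {a..b} R" and nc: "noncrossing R" using R by (auto simp: ncp_def)
  have R_sub: "C \<subseteq> {a..b}" if "C \<in> R" for C using partition_onD1[OF part] that by blast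
  have B: "?B \<in> R" "a \<in> ?B" using block_of_mem[OF part] mem_block_of[OF part] ab by auto
  have finB: "finite ?B" using R_sub[OF B(1)] finite_subset by blast
  have l: "l \<in> ?B" "\<And>x. x \<in> ?B \<Longrightarrow> x \<le> l" unfolding l_def using finB B(2) Max_in Max_ge by blast+
  have al: "a \<le> l" using l B by blast
  have "l \<le> b" using l(1) R_sub[OF B(1)] by auto
  moreover have "l \<noteq> b"
  proof
    assume "l = b"
    then have "block_of R b = ?B" using l(1) by (intro block_of_eq[OF part B(1)]) simp
    then show False using a B(2) by simp
  qed
  ultimately have lb: "l < b" by simp
  have split: "C \<in> P \<or> C \<in> Q" if C: "C \<in> R" for C
  proof (cases "C = ?B")
    case True
    then have "C \<subseteq> {a..l}" using l(2) R_sub[OF C] by auto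
    then show ?thesis using C by (simp add: P_def)
  next
    case False
    have neq: "x \<noteq> a" "x \<noteq> l" if "x \<in> C" for x
      using partition_on_unique[OF part C B(1), of x] that False B(2) l(1) by auto
    have "\<not> (u < l \<and> l < v)" if "u \<in> C" "v \<in> C" for u v
    proof
      assume *: "u < l \<and> l < v"
      have "a < u" using neq(1)[OF that(1)] R_sub[OF C] that(1) by fastforce
      then show False
        using noncrossingD[OF nc B(1) C B(2) that(1) l(1) that(2)] * False by simp
    qed
    then have "(\<forall>u\<in>C. u < l) \<or> (\<forall>u\<in>C. l < u)" using neq(2) by (metis linorder_neqE_nat)
    then have "C \<subseteq> {a..l} \<or> C \<subseteq> {Suc l..b}" using R_sub[OF C] by fastforce
    then show ?thesis using C by (simp add: P_def Q_def)
  qed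
  have PQ: "R = P \<union> Q" using split by (auto simp: P_def Q_def)
  have sub: "S \<subseteq> R \<Longrightarrow> \<Union>S = A \<Longrightarrow> S \<in> ncp A" for S A
  proof -
    assume S: "S \<subseteq> R" "\<Union>S = A"
    have "partition_on A S"
    proof (rule partition_onI[OF S(2)])
      show "disjnt p q" if "p \<in> S" "q \<in> S" "p \<noteq> q" for p q
        using disjointD[OF partition_onD2[OF part], of p q] that S(1) by (auto simp: disjnt_def)
      show "{} \<notin> S" using partition_onD3[OF part] S(1) by blast
    qed
    then show ?thesis using noncrossing_subset[OF nc S(1)] by (simp add: ncp_def)
  qed
  have cover: "x \<in> \<Union>P \<or> x \<in> \<Union>Q" if "x \<in> {a..b}" for x
    using that unfolding partition_onD1[OF part] PQ by simp
  have PU: "\<Union>P \<subseteq> {a..l}" and QU: "\<Union>Q \<subseteq> {Suc l..b}" by (auto simp: P_def Q_def)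
  have U: "\<Union>P = {a..l}" "\<Union>Q = {Suc l..b}"
  proof (intro equalityI PU subsetI)
    fix x assume x: "x \<in> {a..l}"
    then have "x \<notin> \<Union>Q" using QU by (meson atLeastAtMost_iff not_less_eq_eq subsetD)
    then show "x \<in> \<Union>P" using cover[of x] x lb by simp
  next
    show "\<Union>Q = {Suc l..b}"
    proof (intro equalityI QU subsetI)
      fix x assume x: "x \<in> {Suc l..b}"
      then have "x \<notin> \<Union>P" using PU by (meson atLeastAtMost_iff not_less_eq_eq subsetD)
      then show "x \<in> \<Union>Q" using cover[of x] x al by simp
    qed
  qed
  have P: "P \<in> ncp {a..l}" by (rule sub[OF _ U(1)]) (simp add: P_def)
  have Q: "Q \<in> ncp {Suc l..b}" by (rule sub[OF _ U(2)]) (simp add: Q_def)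
  have "?B \<in> P" using l(2) B R_sub[OF B(1)] by (auto simp: P_def)
  then have "block_of P l = ?B" using P l(1) by (intro block_of_eq[of "{a..l}"]) (auto simp: ncp_def)
  then have "a \<in> block_of P l" using B(2) by simp
  then show thesis using that al lb P Q PQ by blast
qed

lemma bij_betw_glue:
  assumes "a \<le> b"
  shows "bij_betw (\<lambda>(l, P, Q). P \<union> Q)
    (SIGMA l:{a..<b}. {P \<in> ncp {a..l}. a \<in> block_of P l} \<times> ncp {Suc l..b})
    {R \<in> ncp {a..b}. a \<notin> block_of R b}"
    (is "bij_betw ?h ?S ?T")
proof (rule bij_betw_imageI)
  show "inj_on ?h ?S"
  proof (rule inj_onI)
    fix s t assume "s \<in> ?S" "t \<in> ?S" and h: "?h s = ?h t"
    moreover obtain l P Q l' P' Q' where st: "s = (l, P, Q)" "t = (l', P', Q')"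
      by (metis prod_cases3)
    ultimately have 1: "a \<le> l" "l < b" "P \<in> ncp {a..l}" "a \<in> block_of P l" "Q \<in> ncp {Suc l..b}"
      and 2: "a \<le> l'" "l' < b" "P' \<in> ncp {a..l'}" "a \<in> block_of P' l'" "Q' \<in> ncp {Suc l'..b}"
      and eq: "P \<union> Q = P' \<union> Q'"
      by auto
    have "l = l'" using Max_block_of_glue[OF 1] Max_block_of_glue[OF 2] eq by simp
    then show "s = t"
      unfolding st using glue_restrict[OF 1] glue_restrict[OF 2] eq by simp
  qed
  show "?h ` ?S = ?T"
  proof
    show "?h ` ?S \<subseteq> ?T"
      using glue_ncp a_notin_block_of_glue by auto
    show "?T \<subseteq> ?h ` ?S"
    proof
      fix R assume "R \<in> ?T"
      then have "R \<in> ncp {a..b}" "a \<notin> block_of R b" by auto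
      then obtain l P Q where "a \<le> l" "l < b" "P \<in> ncp {a..l}" "a \<in> block_of P l" "Q \<in> ncp {Suc l..b}" "R = P \<union> Q"
        using unglue[OF _ assms] by metis
      then have "R = ?h (l, P, Q)" "(l, P, Q) \<in> ?S" by auto
      then show "R \<in> ?h ` ?S" by (rule image_eqI)
    qed
  qed
qed

section \<open>Generating functions of rooted partitions\<close>

text \<open>The shift by one lets p and q count the elements other than \<open>b\<close>; they
  become the exponents of \<beta> and \<omega>.\<close>

definition root_gf :: "(nat \<Rightarrow> 'a::comm_semiring_1) \<Rightarrow> (nat \<Rightarrow> 'a) \<Rightarrow> nat \<Rightarrow> nat \<Rightarrow> nat \<Rightarrow> nat \<Rightarrow> 'a" where
  "root_gf f g a b p q = (\<Sum>P\<in>ncp {a..b}.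
     if card (block_of P b) = Suc q \<and> card (dual_class {a..b} P b) = Suc p
     then weight f g {a..b} b P else 0)"

text \<open>Blocks later receive an indeterminate for \<open>x\<close>, dual blocks the value 1: the
  number of large dual blocks is determined by the number of points and of large blocks.\<close>

definition size_weight :: "nat \<Rightarrow> 'a::comm_semiring_1 \<Rightarrow> nat \<Rightarrow> 'a" where
  "size_weight d x c = (if c = 1 then 1 else if c = d + 1 then x else 0)"

text \<open>Case distinction on whether \<open>a\<close> lies in the block of \<open>b\<close>,
  through the bijections for \<open>cap\<close> and for gluing.\<close>

lemma sum_ncp:
  assumes "a < b"
  shows "(\<Sum>R\<in>ncp {a..b}. F R) = (\<Sum>P\<in>ncp {Suc a..b}. F (cap a b P)) +
    (\<Sum>l\<in>{a..<b}. \<Sum>P\<in>{P \<in> ncp {a..l}. a \<in> block_of P l}. \<Sum>Q\<in>ncp {Suc l..b}. F (P \<union> Q))"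
proof -
  have "ncp {a..b} = {R \<in> ncp {a..b}. a \<in> block_of R b} \<union> {R \<in> ncp {a..b}. a \<notin> block_of R b}"
    by blast
  then have "(\<Sum>R\<in>ncp {a..b}. F R) =
    (\<Sum>R\<in>{R \<in> ncp {a..b}. a \<in> block_of R b}. F R) + (\<Sum>R\<in>{R \<in> ncp {a..b}. a \<notin> block_of R b}. F R)"
    by (subst (1) \<open>ncp {a..b} = _\<close>, intro sum.union_disjoint) (auto simp: finite_ncp)
  also have "(\<Sum>R\<in>{R \<in> ncp {a..b}. a \<in> block_of R b}. F R) = (\<Sum>P\<in>ncp {Suc a..b}. F (cap a b P))"
    using sum.reindex_bij_betw[OF bij_betw_cap[OF assms]] by metis
  also have "(\<Sum>R\<in>{R \<in> ncp {a..b}. a \<notin> block_of R b}. F R) =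
    (\<Sum>s\<in>(SIGMA l:{a..<b}. {P \<in> ncp {a..l}. a \<in> block_of P l} \<times> ncp {Suc l..b}).
       F (case s of (l, P, Q) \<Rightarrow> P \<union> Q))"
    using sum.reindex_bij_betw[OF bij_betw_glue, of a b F] assms by simp
  also have "\<dots> = (\<Sum>l\<in>{a..<b}. \<Sum>(P, Q)\<in>{P \<in> ncp {a..l}. a \<in> block_of P l} \<times> ncp {Suc l..b}. F (P \<union> Q))"
    by (subst sum.Sigma) (auto simp: finite_ncp split_def)
  also have "\<dots> = (\<Sum>l\<in>{a..<b}. \<Sum>P\<in>{P \<in> ncp {a..l}. a \<in> block_of P l}. \<Sum>Q\<in>ncp {Suc l..b}. F (P \<union> Q))"
    by (simp add: sum.cartesian_product)
  finally show ?thesis .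
qed

lemma card_dual_class_pos: "a \<le> b \<Longrightarrow> card (dual_class {a..b} P b) > 0"
  by (auto simp: card_gt_0_iff dual_class_def)

lemma card_block_of_pos:
  assumes "a \<le> b" "P \<in> ncp {a..b}"
  shows "card (block_of P b) > 0"
proof -
  have part: "partition_on {a..b} P" and b: "b \<in> {a..b}" using assms by (auto simp: ncp_def)
  have "block_of P b \<subseteq> {a..b}"
    using block_of_mem[OF part b] partition_onD1[OF part] by blast
  then show ?thesis
    using mem_block_of[OF part b] finite_subset by (auto simp: card_gt_0_iff)
qed

lemma ncp_singleton: "ncp {a} = {{{a}}}"
proof
  show "ncp {a} \<subseteq> {{{a}}}"
  proof
    fix P assume "P \<in> ncp {a}"
    then have part: "partition_on {a} P" by (simp add: ncp_def)
    have "B = {a}" if "B \<in> P" for B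
    proof -
      have "B \<subseteq> {a}" "B \<noteq> {}" using that partition_onD1[OF part] partition_onD3[OF part] by auto
      then show ?thesis by blast
    qed
    moreover have "P \<noteq> {}" using partition_onD1[OF part] by auto
    ultimately show "P \<in> {{{a}}}" by blast
  qed
  show "{{{a}}} \<subseteq> ncp {a}"
    by (auto simp: ncp_def noncrossing_def intro: partition_on_space)
qed

text \<open>Capping makes the dual class of \<open>b\<close> a singleton, whereas gluing adds
  \<open>l\<close> to it.\<close>

lemma first_in_block_of_last_iff:
  assumes ab: "a \<le> b" and P: "P \<in> ncp {a..b}"
  shows "a \<in> block_of P b \<longleftrightarrow> card (dual_class {a..b} P b) = Suc 0"
proof (cases "a = b")
  case True
  then have "P = {{a}}" using P ncp_singleton[of a] by simp
  then have "a \<in> block_of P b" using True by (auto simp: block_of_def)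
  moreover have "dual_class {a..b} P b = {b}" using True by (auto simp: dual_class_def)
  ultimately show ?thesis by simp
next
  case False
  then have lt: "a < b" using ab by simp
  show ?thesis
  proof
    assume "a \<in> block_of P b"
    then obtain Q where "Q \<in> ncp {Suc a..b}" "P = cap a b Q" using uncap[OF lt P] by metis
    then show "card (dual_class {a..b} P b) = Suc 0" using dual_class_cap_b[OF lt] by simp
  next
    assume 1: "card (dual_class {a..b} P b) = Suc 0"
    show "a \<in> block_of P b"
    proof (rule ccontr)
      assume "a \<notin> block_of P b"
      from unglue[OF P ab this] obtain l P' Q where
        *: "a \<le> l" "l < b" "P' \<in> ncp {a..l}" "a \<in> block_of P' l" "Q \<in> ncp {Suc l..b}" "P = P' \<union> Q"
        by metis
      have "card (dual_class {Suc l..b} Q b) > 0" using *(2) by (intro card_dual_class_pos) simp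
      then show False using card_dual_class_glue_b[OF *(1-5)] 1 *(6) by simp
    qed
  qed
qed

lemma root_gf_singleton: "root_gf f g a a p q = (if p = 0 \<and> q = 0 then 1 else 0)"
proof -
  have "block_of {{a}} a = {a}" by (rule block_of_eq[OF partition_on_space]) simp_all
  moreover have "dual_class {a} {{a}} a = {a}" by (auto simp: dual_class_def)
  ultimately show ?thesis by (auto simp: root_gf_def ncp_singleton weight_def dual_def)
qed

context
  fixes d :: nat and x :: "'a::comm_semiring_1"
  assumes d: "d \<ge> 1"
begin

abbreviation (input) "gf \<equiv> root_gf (size_weight d x) (size_weight d 1)"
abbreviation (input) "wt A r \<equiv> weight (size_weight d x) (size_weight d 1) A r"

text \<open>Counterpart of \<omega>^(q+1) = t (\<omega>^q + \<beta>^d \<omega>^q). Glued partitions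
  have p > 0, so only capped ones count, and their former dual root must now have size 1 or d +
  1.\<close>

lemma root_gf_connected:
  assumes ab: "a < b"
  shows "gf a b 0 (Suc q) = gf (Suc a) b 0 q + gf (Suc a) b d q" "gf a b 0 0 = 0"
proof -
  let ?D = "\<lambda>P. dual_class {Suc a..b} P b"
  have glue0: "card (dual_class {a..b} (P \<union> Q) b) \<noteq> Suc 0"
    if "l \<in> {a..<b}" "P \<in> {P \<in> ncp {a..l}. a \<in> block_of P l}" "Q \<in> ncp {Suc l..b}" for l P Q
    using card_dual_class_glue_b[of a l b P Q] card_dual_class_pos[of "Suc l" b Q] that by auto
  have 1: "gf a b 0 q = (\<Sum>P\<in>ncp {Suc a..b}.
      if card (block_of P b) = q then size_weight d 1 (card (?D P)) * wt {Suc a..b} b P else 0)" for q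
  proof -
    have "gf a b 0 q = (\<Sum>P\<in>ncp {Suc a..b}.
      if card (block_of (cap a b P) b) = Suc q \<and> card (dual_class {a..b} (cap a b P) b) = Suc 0
      then wt {a..b} b (cap a b P) else 0)"
      unfolding root_gf_def sum_ncp[OF ab] using glue0 by simp
    also have "\<dots> = (\<Sum>P\<in>ncp {Suc a..b}.
      if card (block_of P b) = q then size_weight d 1 (card (?D P)) * wt {Suc a..b} b P else 0)"
    proof (intro sum.cong refl)
      fix P assume "P \<in> ncp {Suc a..b}"
      note P = ab this
      show "(if card (block_of (cap a b P) b) = Suc q \<and> card (dual_class {a..b} (cap a b P) b) = Suc 0
          then wt {a..b} b (cap a b P) else 0) =
        (if card (block_of P b) = q then size_weight d 1 (card (?D P)) * wt {Suc a..b} b P else 0)"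
        unfolding card_block_of_cap[OF P] dual_class_cap_b[OF P] weight_cap[OF P] by simp
    qed
    finally show ?thesis .
  qed
  \<comment> \<open>A capped root block has at least two elements.\<close>
  show "gf a b 0 0 = 0"
    unfolding 1 using card_block_of_pos[of "Suc a" b] ab by (intro sum.neutral) fastforce
  have "gf a b 0 (Suc q) = (\<Sum>P\<in>ncp {Suc a..b}.
      (if card (block_of P b) = Suc q \<and> card (?D P) = Suc 0 then wt {Suc a..b} b P else 0) +
      (if card (block_of P b) = Suc q \<and> card (?D P) = Suc d then wt {Suc a..b} b P else 0))"
    unfolding 1 using d by (intro sum.cong) (auto simp: size_weight_def)
  then show "gf a b 0 (Suc q) = gf (Suc a) b 0 q + gf (Suc a) b d q"
    unfolding root_gf_def by (simp add: sum.distrib)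
qed

text \<open>Only glued partitions have p > 0. The root block of the left part becomes unrooted, so
  it has size 1 or d + 1 and the left part yields a coefficient of 1 + x \<omega>^d. The right part
  keeps q and all but one of the dual root's elements.\<close>

lemma root_gf_disconnected:
  assumes ab: "a < b"
  shows "gf a b (Suc p) q = (\<Sum>l\<in>{a..<b}. (gf a l 0 0 + x * gf a l 0 d) * gf (Suc l) b p q)"
proof -
  have first: "(\<Sum>P\<in>{P \<in> ncp {a..l}. a \<in> block_of P l}. size_weight d x (card (block_of P l)) * wt {a..l} l P)
      = gf a l 0 0 + x * gf a l 0 d" if "l \<in> {a..<b}" for l
  proof -
    have "(\<Sum>P\<in>{P \<in> ncp {a..l}. a \<in> block_of P l}. size_weight d x (card (block_of P l)) * wt {a..l} l P)
      = (\<Sum>P\<in>ncp {a..l}. if a \<in> block_of P l then size_weight d x (card (block_of P l)) * wt {a..l} l P else 0)"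
      by (intro sum.inter_filter finite_ncp) simp
    also have "\<dots> = (\<Sum>P\<in>ncp {a..l}.
      (if card (block_of P l) = Suc 0 \<and> card (dual_class {a..l} P l) = Suc 0 then wt {a..l} l P else 0) +
      x * (if card (block_of P l) = Suc d \<and> card (dual_class {a..l} P l) = Suc 0 then wt {a..l} l P else 0))"
      \<comment> \<open>The condition that \<open>a\<close> is in the block of \<open>l\<close> is
        rewritten as p = 0.\<close>
      using first_in_block_of_last_iff[of a l] that d by (intro sum.cong) (auto simp: size_weight_def)
    finally show ?thesis unfolding root_gf_def by (simp only: sum.distrib sum_distrib_left[symmetric])
  qed
  have "gf a b (Suc p) q = (\<Sum>l\<in>{a..<b}. \<Sum>P\<in>{P \<in> ncp {a..l}. a \<in> block_of P l}. \<Sum>Q\<in>ncp {Suc l..b}.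
      if card (block_of (P \<union> Q) b) = Suc q \<and> card (dual_class {a..b} (P \<union> Q) b) = Suc (Suc p)
      then wt {a..b} b (P \<union> Q) else 0)"
    unfolding root_gf_def sum_ncp[OF ab] using dual_class_cap_b[OF ab] by simp
  also have "\<dots> = (\<Sum>l\<in>{a..<b}. \<Sum>P\<in>{P \<in> ncp {a..l}. a \<in> block_of P l}. \<Sum>Q\<in>ncp {Suc l..b}.
      size_weight d x (card (block_of P l)) * wt {a..l} l P *
      (if card (block_of Q b) = Suc q \<and> card (dual_class {Suc l..b} Q b) = Suc p
       then wt {Suc l..b} b Q else 0))"
  proof (intro sum.cong refl)
    fix l P Q
    assume "l \<in> {a..<b}" "P \<in> {P \<in> ncp {a..l}. a \<in> block_of P l}" "Q \<in> ncp {Suc l..b}"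
    then have *: "a \<le> l" "l < b" "P \<in> ncp {a..l}" "a \<in> block_of P l" "Q \<in> ncp {Suc l..b}" by auto
    show "(if card (block_of (P \<union> Q) b) = Suc q \<and> card (dual_class {a..b} (P \<union> Q) b) = Suc (Suc p)
        then wt {a..b} b (P \<union> Q) else 0) =
      size_weight d x (card (block_of P l)) * wt {a..l} l P *
      (if card (block_of Q b) = Suc q \<and> card (dual_class {Suc l..b} Q b) = Suc p
       then wt {Suc l..b} b Q else 0)"
      unfolding block_of_glue_b(1)[OF *] card_dual_class_glue_b[OF *] weight_glue[OF *] by simp
  qed
  also have "\<dots> = (\<Sum>l\<in>{a..<b}.
      (\<Sum>P\<in>{P \<in> ncp {a..l}. a \<in> block_of P l}. size_weight d x (card (block_of P l)) * wt {a..l} l P) *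
      gf (Suc l) b p q)"
    unfolding root_gf_def by (simp only: sum_product)
  also have "\<dots> = (\<Sum>l\<in>{a..<b}. (gf a l 0 0 + x * gf a l 0 d) * gf (Suc l) b p q)"
    by (intro sum.cong refl arg_cong2[where f = "(*)"] first)
  finally show ?thesis .
qed

text \<open>The tree of a partition of m + 1 points has m + 2 vertices, of which \<open>m\<close>
  are unrooted and carry t. For p > 0 the convolution multiplies 1 + x \<omega>^d by \<beta>^(p-1)
  \<omega>^q.\<close>

lemma root_gf_eq_forest_gf: "gf a (a + m) p q = forest_gf x d p q m"
proof (induction m arbitrary: a p q rule: less_induct)
  case (less m)
  show ?case
  proof (cases m)
    case 0
    then show ?thesis by (simp add: root_gf_singleton)
  next
    case m: (Suc n)
    have lt: "a < a + m" using m by simp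
    have IH: "gf (Suc a) (a + m) p q = forest_gf x d p q n" for a p q
      using less.IH[of n "Suc a"] m by simp
    show ?thesis
    proof (cases p)
      case p: 0
      show ?thesis
      proof (cases q)
        case 0
        then show ?thesis using root_gf_connected(2)[OF lt] by (simp add: p m)
      next
        case (Suc r)
        then have "gf a (a + m) p q = gf (Suc a) (a + m) 0 r + gf (Suc a) (a + m) d r"
          using root_gf_connected(1)[OF lt] p by simp
        then show ?thesis unfolding IH by (simp add: p m Suc)
      qed
    next
      case p: (Suc r)
      have "gf a (a + m) p q = (\<Sum>l\<in>{a..<a + m}. (gf a l 0 0 + x * gf a l 0 d) * gf (Suc l) (a + m) r q)"
        unfolding p by (rule root_gf_disconnected[OF lt])
      also have "\<dots> = (\<Sum>k\<le>n. (gf a (a + k) 0 0 + x * gf a (a + k) 0 d) * gf (Suc (a + k)) (a + m) r q)"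
        by (rule sum.reindex_bij_witness[of _ "\<lambda>k. a + k" "\<lambda>l. l - a"]) (auto simp: m)
      also have "\<dots> = (\<Sum>k\<le>n. (forest_gf x d 0 0 k + x * forest_gf x d 0 d k) * forest_gf x d r q (n - k))"
      proof (intro sum.cong refl)
        fix k assume "k \<in> {..n}"
        then have "a + m = Suc (a + k) + (n - k)" "k < m" "n - k < m" using m by auto
        then show "(gf a (a + k) 0 0 + x * gf a (a + k) 0 d) * gf (Suc (a + k)) (a + m) r q =
          (forest_gf x d 0 0 k + x * forest_gf x d 0 d k) * forest_gf x d r q (n - k)"
          by (simp only: less.IH)
      qed
      also have "\<dots> = (\<Sum>k\<le>n. forest_gf x d 0 0 k * forest_gf x d r q (n - k)) +
          x * (\<Sum>k\<le>n. forest_gf x d 0 d k * forest_gf x d r q (n - k))"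
        by (simp add: algebra_simps sum.distrib sum_distrib_left)
      also have "\<dots> = forest_gf x d p q m"
        unfolding forest_gf_convolution by (simp add: p m add.commute)
      finally show ?thesis .
    qed
  qed
qed

text \<open>Weighting the two roots as well gives (1 + \<beta>^d) (1 + x \<omega>^d) = \<beta>
  \<omega> / t^2, whence the index m + 2.\<close>

lemma sum_ncp_eq_forest_gf:
  "(\<Sum>P\<in>ncp {a..a + m}. (\<Prod>B\<in>P. size_weight d x (card B)) *
      (\<Prod>V\<in>dual {a..a + m} P. size_weight d 1 (card V))) = forest_gf x d 1 1 (m + 2)"
proof -
  let ?b = "a + m"
  let ?D = "\<lambda>P. dual_class {a..?b} P ?b"
  let ?I = "\<lambda>p q P. if card (block_of P ?b) = Suc q \<and> card (?D P) = Suc p then wt {a..?b} ?b P else 0"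
  have "(\<Sum>P\<in>ncp {a..?b}. (\<Prod>B\<in>P. size_weight d x (card B)) *
      (\<Prod>V\<in>dual {a..?b} P. size_weight d 1 (card V))) =
    (\<Sum>P\<in>ncp {a..?b}. (?I 0 0 P + ?I d 0 P) + x * (?I 0 d P + ?I d d P))"
  proof (intro sum.cong refl)
    fix P assume "P \<in> ncp {a..?b}"
    then have part: "partition_on {a..?b} P" by (simp add: ncp_def)
    have "finite P" using finite_elements[OF _ part] by simp
    moreover have "block_of P ?b \<in> P" using block_of_mem[OF part] by simp
    ultimately have 1: "(\<Prod>B\<in>P. size_weight d x (card B)) =
        size_weight d x (card (block_of P ?b)) * (\<Prod>B\<in>P - {block_of P ?b}. size_weight d x (card B))"
      by (rule prod.remove)
    have 2: "(\<Prod>V\<in>dual {a..?b} P. size_weight d 1 (card V)) =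
        size_weight d 1 (card (?D P)) * (\<Prod>V\<in>dual {a..?b} P - {?D P}. size_weight d (1::'a) (card V))"
      by (rule prod.remove) (simp_all add: dual_def)
    have "(\<Prod>B\<in>P. size_weight d x (card B)) * (\<Prod>V\<in>dual {a..?b} P. size_weight d 1 (card V)) =
        size_weight d x (card (block_of P ?b)) * size_weight d 1 (card (?D P)) * wt {a..?b} ?b P"
      unfolding 1 2 weight_def by (simp add: mult_ac)
    also have "\<dots> = (?I 0 0 P + ?I d 0 P) + x * (?I 0 d P + ?I d d P)"
      using d by (auto simp: size_weight_def)
    finally show "(\<Prod>B\<in>P. size_weight d x (card B)) * (\<Prod>V\<in>dual {a..?b} P. size_weight d 1 (card V)) =
      (?I 0 0 P + ?I d 0 P) + x * (?I 0 d P + ?I d d P)" .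
  qed
  also have "\<dots> = (gf a ?b 0 0 + gf a ?b d 0) + x * (gf a ?b 0 d + gf a ?b d d)"
    unfolding root_gf_def by (simp only: sum.distrib sum_distrib_left[symmetric])
  also have "\<dots> = forest_gf x d 1 1 (m + 2)"
    unfolding root_gf_eq_forest_gf by (simp add: numeral_2_eq_2)
  finally show ?thesis .
qed

end

section \<open>Extraction of coefficients and the closed formula\<close>

lemma prod_size_weight:
  assumes "finite S" "d \<ge> 1"
  shows "(\<Prod>B\<in>S. size_weight d x (card B)) =
    (if \<forall>B\<in>S. card B = 1 \<or> card B = d + 1 then x ^ card {B \<in> S. card B = d + 1} else 0)"
  using assms(1)
proof (induction S rule: finite_induct)
  case (insert C S)
  have "{B \<in> insert C S. card B = d + 1} =
    (if card C = d + 1 then insert C {B \<in> S. card B = d + 1} else {B \<in> S. card B = d + 1})"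
    by auto
  then show ?case using insert assms(2) by (auto simp: size_weight_def)
qed simp

text \<open>The weight of P is a power of x counting its large blocks if all sizes are admissible,
  and 0 otherwise, so its coefficient at x^j is an indicator.\<close>

lemma card_ncp_eq_coeff:
  fixes d m j :: nat
  assumes d: "d \<ge> 1"
  shows "real (card {P \<in> ncp {a..a + m}. (\<forall>B\<in>P. card B = 1 \<or> card B = d + 1) \<and>
      (\<forall>V\<in>dual {a..a + m} P. card V = 1 \<or> card V = d + 1) \<and> card {B \<in> P. card B = d + 1} = j})
    = coeff (forest_gf [:0, 1:] d 1 1 (m + 2)) j"
proof -
  let ?ok = "\<lambda>S :: nat set set. \<forall>B\<in>S. card B = 1 \<or> card B = d + 1"
  have "coeff (forest_gf [:0, 1:] d 1 1 (m + 2)) j =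
    (\<Sum>P\<in>ncp {a..a + m}. coeff ((\<Prod>B\<in>P. size_weight d [:0, 1:] (card B)) *
      (\<Prod>V\<in>dual {a..a + m} P. size_weight d 1 (card V))) j :: real)"
    unfolding sum_ncp_eq_forest_gf[OF d, where a = a and x = "[:0, 1:]", symmetric] by (rule coeff_sum)
  also have "\<dots> = (\<Sum>P\<in>ncp {a..a + m}.
    if ?ok P \<and> ?ok (dual {a..a + m} P) \<and> card {B \<in> P. card B = d + 1} = j then 1 else 0)"
  proof (intro sum.cong refl)
    fix P assume "P \<in> ncp {a..a + m}"
    then have fin: "finite P" using finite_elements[of "{a..a + m}" P] by (simp add: ncp_def)
    have fin': "finite (dual {a..a + m} P)" by (simp add: dual_def)
    have pow: "coeff ([:0, 1:] ^ k) j = (if k = j then 1 else 0 :: real)" for k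
      using coeff_monom[of "1 :: real" k j] by (simp add: monom_altdef)
    show "coeff ((\<Prod>B\<in>P. size_weight d [:0, 1:] (card B)) *
        (\<Prod>V\<in>dual {a..a + m} P. size_weight d 1 (card V))) j =
      (if ?ok P \<and> ?ok (dual {a..a + m} P) \<and> card {B \<in> P. card B = d + 1} = j then 1 else 0 :: real)"
      unfolding prod_size_weight[OF fin d] prod_size_weight[OF fin' d] by (auto simp: pow)
  qed
  also have "\<dots> = real (card {P \<in> ncp {a..a + m}.
    ?ok P \<and> ?ok (dual {a..a + m} P) \<and> card {B \<in> P. card B = d + 1} = j})"
    by (simp add: sum.inter_filter[symmetric] finite_ncp)
  finally show ?thesis by simp
qed

text \<open>Each large block accounts for d in the difference between points and blocks; hence the
  rank is the number of large blocks.\<close>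

lemma card_partition_two_sizes:
  assumes "finite A" "partition_on A P" "\<forall>B\<in>P. card B = 1 \<or> card B = d + 1"
  shows "card A = card P + d * card {B \<in> P. card B = d + 1}"
proof -
  have fin: "finite P" using finite_elements assms(1,2) .
  have "card A = (\<Sum>B\<in>P. card B)"
    using assms(1) partition_onD1[OF assms(2)]
    by (intro product_partition[OF assms(2)]) (blast intro: finite_subset)
  also have "\<dots> = (\<Sum>B\<in>P. 1 + (if card B = d + 1 then d else 0))"
    using assms(3) by (intro sum.cong) auto
  also have "\<dots> = card P + (\<Sum>B\<in>{B \<in> P. card B = d + 1}. d)"
    unfolding sum.distrib sum.inter_filter[OF fin] by simp
  finally show ?thesis by simp
qed

lemma coeff_forest_gf_1_1:
  fixes d i j :: nat
  assumes d: "d \<ge> 1"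
  shows "coeff (forest_gf [:0, 1:] d 1 1 (d * (i + j) + 2)) j =
    real (d * (i + j) + 1) / (real (d * j + 1) * real (d * i + 1))
      * real ((d * j + 1) choose i) * real ((d * i + 1) choose j)"
proof (cases i)
  \<comment> \<open>The Lagrange formula covers only positive exponents of v, so i = 0 is treated
    apart.\<close>
  case 0
  have "coeff (forest_gf [:0, 1:] d 1 1 (d * j + 2)) j = real (1 choose j)"
    using coeff_forest_gf_i_0[OF d, of "d * j + 2" 1 1 j] by simp
  moreover have "1 + real d * real j > 0" by (simp add: add_pos_nonneg)
  ultimately show ?thesis by (simp add: 0 del: forest_gf.simps)
next
  case i: (Suc i')
  let ?c = "coeff (forest_gf [:0, 1:] d 1 1 (d * (i + j) + 2)) j :: real"
  let ?N = "d * i" and ?M = "d * j"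
  have 1: "real i * ?c = real (?M choose i') * (real ((?N + 1) choose j)
      + (if j = 0 then 0 else real d * real (?N choose (j - 1))))"
    using coeff_forest_gf_i_Suc[OF d, of "d * (i + j) + 2" 1 1 i' j] i by simp
  have 2: "real i * real ((?M + 1) choose i) = real (?M + 1) * real (?M choose i')"
    using Suc_times_binomial_eq[of ?M i'] unfolding i by (metis Suc_eq_plus1 of_nat_mult mult.commute)
  have 3: "real j * real ((?N + 1) choose j) = real (?N + 1) * (if j = 0 then 0 else real (?N choose (j - 1)))"
  proof (cases j)
    case (Suc j')
    have "real (Suc ?N * (?N choose j')) = real ((Suc ?N choose Suc j') * Suc j')"
      by (simp only: Suc_times_binomial_eq)
    then have "real (Suc j') * real (Suc ?N choose Suc j') = real (Suc ?N) * real (?N choose j')"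
      by (simp only: of_nat_mult mult.commute)
    then show ?thesis using Suc by (simp only: Suc_eq_plus1[symmetric]) simp
  qed simp
  have "real i * (real (?M + 1) * real (?N + 1) * ?c) =
    real (?M + 1) * real (?M choose i') * (real (?N + 1) * real ((?N + 1) choose j)
      + real d * (real (?N + 1) * (if j = 0 then 0 else real (?N choose (j - 1)))))"
  proof -
    have "real i * (real (?M + 1) * real (?N + 1) * ?c) = real (?M + 1) * real (?N + 1) * (real i * ?c)"
      by (simp only: mult_ac)
    then show ?thesis unfolding 1 by (simp add: algebra_simps)
  qed
  \<comment> \<open>Absorption in both binomials leaves the factor (d i + 1) + d j = d (i + j) +
    1.\<close>
  also have "\<dots> = real i * (real (d * (i + j) + 1) * real ((?M + 1) choose i) * real ((?N + 1) choose j))"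
    unfolding 2[symmetric] 3[symmetric] by (simp add: algebra_simps)
  finally have "real (?M + 1) * real (?N + 1) * ?c =
      real (d * (i + j) + 1) * real ((?M + 1) choose i) * real ((?N + 1) choose j)"
    using i by simp
  moreover have nz: "real (?M + 1) * real (?N + 1) \<noteq> 0"
    by (simp only: mult_eq_0_iff of_nat_eq_0_iff) simp
  ultimately have "?c = real (d * (i + j) + 1) * real ((?M + 1) choose i) * real ((?N + 1) choose j)
      / (real (?M + 1) * real (?N + 1))"
    by (subst nonzero_eq_divide_eq[OF nz]) (simp only: mult_ac)
  then show ?thesis by (simp only: times_divide_eq_left)
qed

theorem theorem4p6:
  fixes d i j k :: nat
  assumes "d \<ge> 1" and "i + j = k"
  shows "real (card {P \<in> NC_mod d (d * k + 1).
                       NC_rank d (d * k + 1) P = real j \<and>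
                       (\<forall>B\<in>P. card B = 1 \<or> card B = d + 1) \<and>
                       (\<forall>B\<in>kreweras (d * k + 1) P. card B = 1 \<or> card B = d + 1)})
       = real (d * k + 1) / (real (d * j + 1) * real (d * i + 1))
           * real ((d * j + 1) choose i) * real ((d * i + 1) choose j)"
proof -
  let ?n = "d * k + 1"
  \<comment> \<open>The prescribed sizes imply the congruences in \<open>NC_mod\<close>.\<close>
  have cong: "[card B = 1] (mod d)" if "card B = 1 \<or> card B = d + 1" for B :: "nat set"
    using that by (elim disjE) (simp_all only: cong_def mod_add_self1)
  have rank: "NC_rank d ?n P = real j \<longleftrightarrow> card {B \<in> P. card B = d + 1} = j"
    if "P \<in> ncp {1..?n}" "\<forall>B\<in>P. card B = 1 \<or> card B = d + 1" for P
  proof -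
    have "?n = card P + d * card {B \<in> P. card B = d + 1}"
      using card_partition_two_sizes[of "{1..?n}" P d] that by (simp add: ncp_def)
    then have "real ?n - real (card P) = real d * real (card {B \<in> P. card B = d + 1})"
      by (metis add_diff_cancel_left' of_nat_add of_nat_mult)
    then show ?thesis using assms(1) by (simp add: NC_rank_def)
  qed
  have NC: "NC ?n = ncp {1..?n}" by (simp add: NC_def ncp_def)
  have "{P \<in> NC_mod d ?n. NC_rank d ?n P = real j \<and> (\<forall>B\<in>P. card B = 1 \<or> card B = d + 1) \<and>
      (\<forall>B\<in>kreweras ?n P. card B = 1 \<or> card B = d + 1)} =
    {P \<in> ncp {1..?n}. (\<forall>B\<in>P. card B = 1 \<or> card B = d + 1) \<and>
      (\<forall>V\<in>dual {1..?n} P. card V = 1 \<or> card V = d + 1) \<and> card {B \<in> P. card B = d + 1} = j}"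
  proof (rule Collect_cong)
    fix P
    show "P \<in> NC_mod d ?n \<and> NC_rank d ?n P = real j \<and> (\<forall>B\<in>P. card B = 1 \<or> card B = d + 1) \<and>
        (\<forall>B\<in>kreweras ?n P. card B = 1 \<or> card B = d + 1) \<longleftrightarrow>
      P \<in> ncp {1..?n} \<and> (\<forall>B\<in>P. card B = 1 \<or> card B = d + 1) \<and>
        (\<forall>V\<in>dual {1..?n} P. card V = 1 \<or> card V = d + 1) \<and> card {B \<in> P. card B = d + 1} = j"
    proof (cases "P \<in> ncp {1..?n}")
      case True
      then have "kreweras ?n P = dual {1..?n} P" using kreweras_eq_dual NC by metis
      then show ?thesis using True rank[OF True] cong unfolding NC_mod_def NC by blast
    next
      case False
      then show ?thesis unfolding NC_mod_def NC by blast
    qed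
  qed
  \<comment> \<open>Here a = 1 and m = d k, so the index m + 2 equals d (i + j) + 2.\<close>
  then show ?thesis
    using card_ncp_eq_coeff[OF assms(1), of 1 "d * k" j] coeff_forest_gf_1_1[OF assms(1), of i j]
    unfolding assms(2) by (simp add: add.commute)
qed

end
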